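(* Assume $K=K_1=K_2=2$. Let $\alpha>1$ and let $C=C_\alpha$ be such that $$e\,\overline K\sum_{t=1}^\infty\frac{(\log t)(\log(Ct^{1+\alpha}))}{t^{1+\alpha}}\le C\qquad(\overline K=4).$$ Consider the one-arm-per-round variant of M-LUCB described in the context, with $\epsilon=0$ and exploration rate $\beta(t,\delta)=\log\left(Ct^{1+\alpha}/\delta\right)$. It is $\delta$-PAC, that is, for every $\delta\in(0,1)$ and every bandit instance $\bm\mu$ with $\mu_{1,1}>\mu_{2,1}$, $\mathbb P_{\bm\mu}(\mu_{1,1}-\mu_{\hat\imath,1}\le 0)\ge1-\delta$. Moreover, for every such $\bm\mu$, $$\limsup_{\delta\to0}\frac{\mathbb E_{\bm\mu}[\tau_\delta]}{\log(1/\delta)}\le 8\left[\frac{2}{(\mu_{1,1}-\mu_{2,1})^2}+\frac1{(\mu_{1,2}-\mu_{2,1})^2}+\frac1{\max\left[(\mu_{1,1}-\mu_{2,1})^2,(\mu_{2,2}-\mu_{2,1})^2\right]}\right].$$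
   Context: **Bandit model.** There are four arms $P\in\mathcal P=\{(i,j):i,j\in\{1,2\}\}$, each a Bernoulli distribution with unknown mean $\mu_P\in[0,1]$; at each round $t=1,2,\dots$ one chooses an arm $P_t$ (depending on past observations) and observes $X_t$ drawn from the Bernoulli distribution with mean $\mu_{P_t}$ (successive draws of an arm are i.i.d., and arms are independent). $\mathbb P_{\bm\mu},\mathbb E_{\bm\mu}$ denote probability and expectation under $\bm\mu=(\mu_P)_{P\in\mathcal P}$. For the analysis (unknown to the algorithm), actions are labelled so that $\mu_{1,1}\le\mu_{1,2}$, $\mu_{2,1}\le\mu_{2,2}$ and $\mu_{1,1}\ge\mu_{2,1}$; thus the maximin action $i^*\in\operatorname{argmax}_i\min_j\mu_{i,j}$ is $1$. **Confidence bounds.** $N_P(t)=\sum_{s=1}^t\mathbf 1_{(P_s=P)}$, $\hat\mu_P(t)=\frac1{N_P(t)}\sum_{s=1}^tX_s\mathbf 1_{(P_s=P)}$, and $$L_P(t)=\hat\mu_P(t)-\sqrt{\tfrac{\beta(t,\delta)}{2N_P(t)}},\qquad U_P(t)=\hat\mu_P(t)+\sqrt{\tfrac{\beta(t,\delta)}{2N_P(t)}};$$ when $N_P(t)=0$, $L_P(t)=-\infty$ and $U_P(t)=+\infty$ (and $\hat\mu_P(t)$ is given an arbitrary value). **Variant of M-LUCB (two actions per player, $\epsilon=0$).** For every $t\in\{0,1,2,\dots\}$ let $c_i(t)\in\operatorname{argmin}_{j\in\{1,2\}}L_{(i,j)}(t)$, $\hat\imath(t)\in\operatorname{argmax}_i\min_j\hat\mu_{i,j}(t)$,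 $H_t=(\hat\imath(t),c_{\hat\imath(t)}(t))$ and $S_t=(i,c_i(t))$ for the other action $i\neq\hat\imath(t)$ (ties broken arbitrarily). If not yet stopped, the algorithm draws at round $t+1$ only the least drawn of these two arms, $P_{t+1}\in\operatorname{argmin}_{P\in\{H_t,S_t\}}N_P(t)$. It stops at $$\tau_\delta=\inf\Big\{t\in\mathbb N:\ \min_i\Big[\max_{i'\ne i}\min_{j'\in\{1,2\}}U_{(i',j')}(t)-\min_{j\in\{1,2\}}L_{(i,j)}(t)\Big]<0\Big\}$$ and recommends $\hat\imath=\hat\imath(\tau_\delta)$.
   Formalization: It is additionally assumed that C>0 and β(t,δ)≥0 for all t≥1 and δ in (0,1), i.e. C≥1; the series condition also admits tiny C, for which β(1,δ)=log(C/δ)<0 when δ>C, so the confidence bounds are undefined. *)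

theory Defs
  imports "HOL-Probability.Probability"
begin

type_synonym arm = "nat \<times> nat"

text \<open>The observations of the first \<open>t\<close> rounds, \<open>[(P\<^sub>1, X\<^sub>1), \<dots>, (P\<^sub>t, X\<^sub>t)]\<close>;
  a Bernoulli observation is \<open>1\<close> iff the Boolean is true.\<close>

type_synonym history = "(arm \<times> bool) list"

definition arms :: "arm set" where
  "arms = {1, 2} \<times> {1, 2}"

definition bandit_instance :: "(arm \<Rightarrow> real) \<Rightarrow> bool" where
  "bandit_instance \<mu> \<longleftrightarrow>
     (\<forall>p\<in>arms. 0 \<le> \<mu> p \<and> \<mu> p \<le> 1) \<and>
     \<mu> (1,1) \<le> \<mu> (1,2) \<and> \<mu> (2,1) \<le> \<mu> (2,2) \<and> \<mu> (2,1) \<le> \<mu> (1,1)"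

definition num_draws :: "history \<Rightarrow> arm \<Rightarrow> nat" where
  "num_draws h p = count_list (map fst h) p"

text \<open>The argument \<open>v\<close> supplies the arbitrary value of the empirical mean of an undrawn arm.\<close>

definition emp_mean :: "(history \<Rightarrow> arm \<Rightarrow> real) \<Rightarrow> history \<Rightarrow> arm \<Rightarrow> real" where
  "emp_mean v h p =
     (if num_draws h p = 0 then v h p
      else (\<Sum>(q, x)\<leftarrow>h. of_bool (q = p) * of_bool x) / real (num_draws h p))"

text \<open>Below, \<open>\<beta>\<close> is the exploration rate as a function of the round, for a fixed \<open>\<delta>\<close>.\<close>

definition lower_bound ::
    "(nat \<Rightarrow> real) \<Rightarrow> (history \<Rightarrow> arm \<Rightarrow> real) \<Rightarrow> history \<Rightarrow> arm \<Rightarrow> ereal" where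
  "lower_bound \<beta> v h p =
     (if num_draws h p = 0 then - \<infinity>
      else ereal (emp_mean v h p - sqrt (\<beta> (length h) / (2 * real (num_draws h p)))))"

definition upper_bound ::
    "(nat \<Rightarrow> real) \<Rightarrow> (history \<Rightarrow> arm \<Rightarrow> real) \<Rightarrow> history \<Rightarrow> arm \<Rightarrow> ereal" where
  "upper_bound \<beta> v h p =
     (if num_draws h p = 0 then \<infinity>
      else ereal (emp_mean v h p + sqrt (\<beta> (length h) / (2 * real (num_draws h p)))))"

text \<open>No indeterminate difference occurs below: an upper bound is never \<open>-\<infinity>\<close> and a lower
  bound is never \<open>\<infinity>\<close>.\<close>

definition stop_cond :: "(nat \<Rightarrow> real) \<Rightarrow> (history \<Rightarrow> arm \<Rightarrow> real) \<Rightarrow> history \<Rightarrow> bool" where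
  "stop_cond \<beta> v h \<longleftrightarrow>
     (MIN i\<in>{1, 2}. (MAX i'\<in>{1, 2} - {i}. MIN j'\<in>{1, 2}. upper_bound \<beta> v h (i', j'))
                    - (MIN j\<in>{1, 2}. lower_bound \<beta> v h (i, j))) < 0"

text \<open>The choices of an algorithm are functions of the past observations and of a random seed of
  type \<open>'r\<close>, drawn independently of the rewards; the seed allows randomised tie-breaking.\<close>

record 'r algorithm =
  mean0 :: "history \<Rightarrow> arm \<Rightarrow> real"
  best_action :: "'r \<Rightarrow> history \<Rightarrow> nat"
  reply :: "'r \<Rightarrow> history \<Rightarrow> nat \<Rightarrow> nat"
  next_arm :: "'r \<Rightarrow> history \<Rightarrow> arm"

definition other_action :: "nat \<Rightarrow> nat" where
  "other_action i = (if i = 1 then 2 else 1)"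

text \<open>The sampling rule is imposed after stopping as well. This is only a virtual continuation
  of the run, which affects neither the stopping time nor the recommendation.\<close>

definition mlucb_variant :: "(nat \<Rightarrow> real) \<Rightarrow> 'r measure \<Rightarrow> 'r algorithm \<Rightarrow> bool" where
  "mlucb_variant \<beta> R A \<longleftrightarrow>
     (\<forall>h. (\<lambda>r. best_action A r h) \<in> R \<rightarrow>\<^sub>M count_space UNIV \<and>
          (\<lambda>r. next_arm A r h) \<in> R \<rightarrow>\<^sub>M count_space UNIV) \<and>
     (\<forall>r\<in>space R. \<forall>h.
        let v = mean0 A; i = best_action A r h; c = reply A r h;
            H = (i, c i); S = (other_action i, c (other_action i))
        in is_arg_max (\<lambda>k. MIN j\<in>{1, 2}. emp_mean v h (k, j)) (\<lambda>k. k \<in> {1, 2}) i \<and>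
           (\<forall>k\<in>{1, 2}. is_arg_min (\<lambda>j. lower_bound \<beta> v h (k, j)) (\<lambda>j. j \<in> {1, 2}) (c k)) \<and>
           is_arg_min (num_draws h) (\<lambda>p. p \<in> {H, S}) (next_arm A r h))"

text \<open>An outcome is a seed together with a table \<open>y\<close> of rewards, where \<open>y (p, k)\<close> is the
  observation made at the \<open>(k + 1)\<close>-st draw of arm \<open>p\<close>.\<close>

definition bandit_measure ::
    "'r measure \<Rightarrow> (arm \<Rightarrow> real) \<Rightarrow> ('r \<times> (arm \<times> nat \<Rightarrow> bool)) measure" where
  "bandit_measure R \<mu> =
     R \<Otimes>\<^sub>M (\<Pi>\<^sub>M (p, k)\<in>arms \<times> UNIV. measure_pmf (bernoulli_pmf (\<mu> p)))"

primrec run :: "'r algorithm \<Rightarrow> 'r \<times> (arm \<times> nat \<Rightarrow> bool) \<Rightarrow> nat \<Rightarrow> history" where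
  "run A \<omega> 0 = []"
| "run A \<omega> (Suc t) =
     (let h = run A \<omega> t; p = next_arm A (fst \<omega>) h
      in h @ [(p, snd \<omega> (p, num_draws h p))])"

definition stopping_time ::
    "(nat \<Rightarrow> real) \<Rightarrow> 'r algorithm \<Rightarrow> 'r \<times> (arm \<times> nat \<Rightarrow> bool) \<Rightarrow> enat" where
  "stopping_time \<beta> A \<omega> = Inf {enat t | t. stop_cond \<beta> (mean0 A) (run A \<omega> t)}"

definition expected_stopping_time ::
    "'r measure \<Rightarrow> (arm \<Rightarrow> real) \<Rightarrow> (nat \<Rightarrow> real) \<Rightarrow> 'r algorithm \<Rightarrow> ennreal" where
  "expected_stopping_time R \<mu> \<beta> A =
     (\<integral>\<^sup>+ \<omega>. ennreal_of_enat (stopping_time \<beta> A \<omega>) \<partial>bandit_measure R \<mu>)"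

text \<open>A run that never stops makes no recommendation and does not count as a success.\<close>

definition correct_event ::
    "'r measure \<Rightarrow> (arm \<Rightarrow> real) \<Rightarrow> (nat \<Rightarrow> real) \<Rightarrow> 'r algorithm
      \<Rightarrow> ('r \<times> (arm \<times> nat \<Rightarrow> bool)) set" where
  "correct_event R \<mu> \<beta> A =
     {\<omega> \<in> space (bandit_measure R \<mu>).
        \<exists>t. stopping_time \<beta> A \<omega> = enat t \<and>
            \<mu> (1,1) - \<mu> (best_action A (fst \<omega>) (run A \<omega> t), 1) \<le> 0}"

definition delta_PAC ::
    "'r measure \<Rightarrow> real \<Rightarrow> (nat \<Rightarrow> real) \<Rightarrow> 'r algorithm \<Rightarrow> bool" where
  "delta_PAC R \<delta> \<beta> A \<longleftrightarrow>
     (\<forall>\<mu>. bandit_instance \<mu> \<and> \<mu> (1,1) > \<mu> (2,1) \<longrightarrow>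
        measure (bandit_measure R \<mu>) (correct_event R \<mu> \<beta> A) \<ge> 1 - \<delta>)"

definition exploration_rate :: "real \<Rightarrow> real \<Rightarrow> real \<Rightarrow> nat \<Rightarrow> real" where
  "exploration_rate \<alpha> C \<delta> t = ln (C * real t powr (1 + \<alpha>) / \<delta>)"

end

theory Submission
  imports Defs "HOL-Real_Asymp.Real_Asymp"
begin

text \<open>In a round \<open>s\<close> in which all confidence intervals are valid and the run does not stop, the
  drawn arm \<open>P\<close> has been drawn at most \<open>8 \<beta>(s, \<delta>) / D\<^sub>P\<close> times, where \<open>D\<^sub>P\<close> is the squared gap
  that \<open>P\<close> contributes to the bound. There is a random round \<open>w\<close>, independent of \<open>\<delta>\<close> and integrable
  because \<open>\<alpha> > 1\<close>, after which the confidence intervals remain valid. Hence a run that has not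
  stopped before round \<open>t\<close> satisfies \<open>t \<le> w + 4 + H \<beta>(t, \<delta>)\<close> with \<open>H\<close> the sum of the \<open>8 / D\<^sub>P\<close>, and
  since \<open>\<beta>(t, \<delta>) = ln (1 / \<delta>) + O(ln t)\<close>, the expected stopping time is at most
  \<open>H ln (1 / \<delta>) / (1 - \<eta>) + O(1)\<close> for each \<open>\<eta> > 0\<close>.

  A wrong recommendation requires one of the three one-sided confidence bounds of \<open>(1,1)\<close>, \<open>(1,2)\<close>
  and \<open>(2,1)\<close> to fail; by Hoeffding's inequality and a union bound over the number of draws this
  has probability at most \<open>\<delta>\<close>.\<close>

subsection \<open>Concentration of the empirical means\<close>

text \<open>Independence means that the joint law is the product of the marginals. Here the joint
  map is the identity, points of the product space being extensional, and each marginal is the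
  corresponding factor.\<close>

lemma indep_vars_PiM_components:
  assumes "I \<noteq> {}" "\<And>i. i \<in> I \<Longrightarrow> prob_space (M i)"
  shows "prob_space.indep_vars (PiM I M) M (\<lambda>i x. x i) I"
proof -
  interpret prob_space "PiM I M" by (rule prob_space_PiM) (fact assms)
  have "distr (PiM I M) (PiM I M) (\<lambda>x. restrict x I) = distr (PiM I M) (PiM I M) (\<lambda>x. x)"
    by (intro distr_cong refl) (auto simp: space_PiM PiE_def extensional_restrict)
  also have "\<dots> = PiM I M"
    by simp
  also have "\<dots> = PiM I (\<lambda>i. distr (PiM I M) (M i) (\<lambda>x. x i))"
    by (intro PiM_cong refl distr_PiM_component[symmetric]) (auto intro: assms)
  finally show ?thesis
    by (subst indep_vars_iff_distr_eq_PiM') (use assms(1) in auto)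
qed

text \<open>The second factor of \<open>bandit_measure\<close>, split off because the deviation
  events concern the rewards alone and not the seed.\<close>

definition reward_table :: "(arm \<Rightarrow> real) \<Rightarrow> (arm \<times> nat \<Rightarrow> bool) measure" where
  "reward_table \<mu> = (\<Pi>\<^sub>M (p, k)\<in>arms \<times> UNIV. measure_pmf (bernoulli_pmf (\<mu> p)))"

text \<open>Since rewards are indexed by draw number, this mean does not depend on the sampling
  rule. For fixed \<open>n\<close> it is an average of independent variables, so that Hoeffding's
  inequality applies directly.\<close>

definition table_mean :: "(arm \<times> nat \<Rightarrow> bool) \<Rightarrow> arm \<Rightarrow> nat \<Rightarrow> real" where
  "table_mean y p n = (\<Sum>k<n. of_bool (y (p, k))) / real n"

lemma prob_space_reward_table: "prob_space (reward_table \<mu>)"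
  unfolding reward_table_def
  by (intro prob_space_PiM) (auto simp: measure_pmf.prob_space_axioms)

text \<open>Stated for every pair of the type because \<open>measurable_run\<close> lets the next
  arm range over the whole type. Off \<open>arms\<close> the coordinate is constantly
  \<open>undefined\<close>.\<close>

lemma measurable_reward [measurable]:
  "(\<lambda>y. y (p, k)) \<in> reward_table \<mu> \<rightarrow>\<^sub>M count_space UNIV"
proof (cases "p \<in> arms")
  case True
  then have "(\<lambda>y. y (p, k)) \<in> reward_table \<mu> \<rightarrow>\<^sub>M measure_pmf (bernoulli_pmf (\<mu> p))"
    using measurable_component_singleton[of "(p, k)" "arms \<times> UNIV"
        "\<lambda>(p, k). measure_pmf (bernoulli_pmf (\<mu> p))"]
    by (simp add: reward_table_def)
  then show ?thesis
    by simp
next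
  case False
  then have "y (p, k) = undefined" if "y \<in> space (reward_table \<mu>)" for y
    using that by (intro PiE_arb[of y "arms \<times> UNIV"]) (auto simp: reward_table_def space_PiM)
  then show ?thesis
    by (subst measurable_cong[of _ _ "\<lambda>_. undefined"]) auto
qed

lemma measurable_table_mean [measurable]:
  "(\<lambda>y. table_mean y p n) \<in> borel_measurable (reward_table \<mu>)"
  unfolding table_mean_def by measurable

lemma Hoeffding_table_mean:
  assumes p: "p \<in> arms" and \<mu>: "0 \<le> \<mu> p" "\<mu> p \<le> 1" and n: "n > 0" and x: "x \<ge> 0"
  shows "measure (reward_table \<mu>) {y\<in>space (reward_table \<mu>). table_mean y p n \<ge> \<mu> p + sqrt (x / (2 * n))}
           \<le> exp (-x)" (is ?ge)
    and "measure (reward_table \<mu>) {y\<in>space (reward_table \<mu>). table_mean y p n \<le> \<mu> p - sqrt (x / (2 * n))}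
           \<le> exp (-x)" (is ?le)
proof -
  interpret prob_space "reward_table \<mu>" by (rule prob_space_reward_table)
  let ?B = "\<lambda>(p, k :: nat). measure_pmf (bernoulli_pmf (\<mu> p))"
  let ?K = "{p} \<times> {..<n}"
  have sum_K: "(\<Sum>i\<in>?K. f i) = (\<Sum>k<n. f (p, k))" for f :: "arm \<times> nat \<Rightarrow> real"
    by (rule sum.reindex_bij_witness[of _ "\<lambda>k. (p, k)" snd]) auto
  define X where "X = (\<lambda>i (y :: arm \<times> nat \<Rightarrow> bool). of_bool (y i) :: real)"
  have "indep_vars ?B (\<lambda>i y. y i) (arms \<times> UNIV)"
    unfolding reward_table_def
    by (rule indep_vars_PiM_components) (use p in \<open>auto simp: measure_pmf.prob_space_axioms\<close>)
  then have "indep_vars ?B (\<lambda>i y. y i) ?K"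
    by (rule indep_vars_subset) (use p in auto)
  then have indep: "indep_vars (\<lambda>_. borel) X ?K"
    unfolding X_def by (rule indep_vars_compose2) auto
  have "expectation (X (p, k)) = \<mu> p" for k
  proof -
    have "distr (reward_table \<mu>) (?B (p, k)) (\<lambda>y. y (p, k)) = ?B (p, k)"
      unfolding reward_table_def
      by (rule distr_PiM_component) (use p in \<open>auto simp: measure_pmf.prob_space_axioms\<close>)
    moreover have "expectation (X (p, k)) = (\<integral>b. of_bool b \<partial>distr (reward_table \<mu>) (?B (p, k)) (\<lambda>y. y (p, k)))"
      using p by (subst integral_distr) (auto simp: X_def)
    ultimately show ?thesis using \<mu> by simp
  qed
  then have E: "(\<Sum>i\<in>?K. expectation (X i)) = n * \<mu> p"
    by (simp add: sum_K)
  interpret indep_interval_bounded_random_variables "reward_table \<mu>" ?K X "\<lambda>_. 0" "\<lambda>_. 1"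
    using indep by unfold_locales (auto simp: X_def)
  interpret Hoeffding_ineq "reward_table \<mu>" ?K X "\<lambda>_. 0" "\<lambda>_. 1" "n * \<mu> p"
    by unfold_locales (simp add: E)
  \<comment> \<open>For a deviation \<open>n * sqrt (x / (2 * n))\<close> of the sum of
    \<open>n\<close> variables with values in [0,1], Hoeffding's exponent is exactly
    \<open>x\<close>.\<close>
  have eps: "2 * (n * sqrt (x / (2 * n)))\<^sup>2 / n = x"
    using n x by (simp add: power_mult_distrib field_simps power2_eq_square)
  have sum: "(\<Sum>i\<in>?K. X i y) = n * table_mean y p n" for y
    using n by (simp add: X_def table_mean_def sum_K)
  from Hoeffding_ineq_ge[of "n * sqrt (x / (2 * n))"] eps x n show ?ge
    by (simp add: sum flip: distrib_left)
  from Hoeffding_ineq_le[of "n * sqrt (x / (2 * n))"] eps x n show ?le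
    by (simp add: sum flip: right_diff_distrib)
qed

subsection \<open>Counting draws along a run\<close>

lemma finite_arms: "finite arms"
  and card_arms: "card arms = 4"
  by (simp_all add: arms_def)

lemma num_draws_Nil [simp]: "num_draws [] p = 0"
  by (simp add: num_draws_def)

lemma num_draws_snoc [simp]: "num_draws (h @ [(q, b)]) p = num_draws h p + (if q = p then 1 else 0)"
  by (simp add: num_draws_def)

lemma length_run [simp]: "length (run A \<omega> t) = t"
  by (induction t) (simp_all add: Let_def)

lemma num_draws_le_length: "num_draws h p \<le> length h"
  by (metis count_le_length length_map num_draws_def)

lemma num_draws_add_le_length:
  assumes "p \<noteq> q"
  shows "num_draws h p + num_draws h q \<le> length h"
  using assms by (induction h) (auto simp: num_draws_def)

text \<open>Each draw of \<open>p\<close> reads the table entry whose index is the number of earlier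
  draws of \<open>p\<close>, so the observed rewards are an initial segment of that column.\<close>

lemma sum_rewards_run:
  "(\<Sum>(q, x)\<leftarrow>run A \<omega> t. of_bool (q = p) * of_bool x) =
     (\<Sum>k<num_draws (run A \<omega> t) p. of_bool (snd \<omega> (p, k)) :: real)"
  by (induction t) (auto simp: Let_def simp del: sum_of_bool_eq)

lemma emp_mean_run:
  "num_draws (run A \<omega> t) p > 0 \<Longrightarrow>
     emp_mean v (run A \<omega> t) p = table_mean (snd \<omega>) p (num_draws (run A \<omega> t) p)"
  by (simp add: emp_mean_def table_mean_def sum_rewards_run)

lemma MIN_actions: "(MIN j\<in>{1, 2 :: nat}. f j) = min (f 1) (f 2 :: 'a :: linorder)"
  by simp

text \<open>With two actions the inner maximum ranges over a singleton, and a difference in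
  \<open>ereal\<close> is negative iff its terms compare strictly, because an upper bound is never
  \<open>-\<infinity>\<close> and a lower bound never \<open>\<infinity>\<close>.\<close>

lemma stop_cond_iff:
  "stop_cond \<beta> v h \<longleftrightarrow>
     (\<exists>i\<in>{1, 2}. (MIN j\<in>{1, 2}. upper_bound \<beta> v h (other_action i, j)) <
                 (MIN j\<in>{1, 2}. lower_bound \<beta> v h (i, j)))"
proof -
  define u where "u = (\<lambda>i. MIN j\<in>{1, 2 :: nat}. upper_bound \<beta> v h (i, j))"
  define l where "l = (\<lambda>i. MIN j\<in>{1, 2 :: nat}. lower_bound \<beta> v h (i, j))"
  have u: "u i \<noteq> -\<infinity>" for i
    unfolding u_def MIN_actions by (auto simp: upper_bound_def min_def)
  have l: "l i \<noteq> \<infinity>" for i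
    unfolding l_def MIN_actions by (auto simp: lower_bound_def min_def)
  have less: "u i - l j < 0 \<longleftrightarrow> u i < l j" for i j
    using u[of i] l[of j] by (cases "u i"; cases "l j") auto
  have "{1, 2} - {1} = {2 :: nat}" "{1, 2} - {2} = {1 :: nat}"
    by auto
  then have "stop_cond \<beta> v h \<longleftrightarrow> min (u 2 - l 1) (u 1 - l 2) < 0"
    unfolding stop_cond_def u_def l_def MIN_actions by (simp del: One_nat_def)
  also have "\<dots> \<longleftrightarrow> u 2 < l 1 \<or> u 1 < l 2"
    by (simp add: min_less_iff_disj less)
  finally show ?thesis
    by (simp add: u_def l_def other_action_def)
qed

text \<open>Whichever action is empirically best, \<open>H\<close> and \<open>S\<close> together are
  the arms \<open>(1, c 1)\<close> and \<open>(2, c 2)\<close>. This puts the sampling rule into a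
  form symmetric in the two actions.\<close>

lemma mlucb_variantE:
  assumes "mlucb_variant \<beta> R A" "r \<in> space R"
  obtains c where "\<forall>i\<in>{1, 2}. c i \<in> {1, 2}"
    and "\<forall>i\<in>{1, 2}. \<forall>j\<in>{1, 2}. lower_bound \<beta> (mean0 A) h (i, c i) \<le> lower_bound \<beta> (mean0 A) h (i, j)"
    and "next_arm A r h \<in> {(1, c 1), (2, c 2)}"
    and "\<forall>i\<in>{1, 2}. num_draws h (next_arm A r h) \<le> num_draws h (i, c i)"
proof -
  define v i c where vic: "v = mean0 A" "i = best_action A r h" "c = reply A r h"
  from assms have
    i: "is_arg_max (\<lambda>k. MIN j\<in>{1, 2}. emp_mean v h (k, j)) (\<lambda>k. k \<in> {1, 2}) i" and
    c: "\<forall>k\<in>{1, 2}. is_arg_min (\<lambda>j. lower_bound \<beta> v h (k, j)) (\<lambda>j. j \<in> {1, 2}) (c k)" and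
    n: "is_arg_min (num_draws h) (\<lambda>p. p \<in> {(i, c i), (other_action i, c (other_action i))}) (next_arm A r h)"
    unfolding mlucb_variant_def Let_def vic by blast+
  from i have "i \<in> {1, 2}"
    by (simp add: is_arg_max_def)
  then have "{(i, c i), (other_action i, c (other_action i))} = {(1, c 1), (2, c 2)}"
    by (auto simp: other_action_def)
  with n have "is_arg_min (num_draws h) (\<lambda>p. p \<in> {(1, c 1), (2, c 2)}) (next_arm A r h)"
    by simp
  with c show thesis
    by (intro that[of c]) (auto simp: is_arg_min_linorder vic)
qed

lemma next_arm_in_arms:
  assumes "mlucb_variant \<beta> R A" "r \<in> space R"
  shows "next_arm A r h \<in> arms"
proof (rule mlucb_variantE[OF assms, of h])
  fix c assume "\<forall>i\<in>{1, 2}. c i \<in> {1, 2 :: nat}" "next_arm A r h \<in> {(1, c 1), (2, c 2)}"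
  then show ?thesis
    by (auto simp: arms_def)
qed

lemma best_action_arg_max:
  assumes "mlucb_variant \<beta> R A" "r \<in> space R"
  shows "is_arg_max (\<lambda>k. MIN j\<in>{1, 2}. emp_mean (mean0 A) h (k, j)) (\<lambda>k. k \<in> {1, 2}) (best_action A r h)"
  using assms unfolding mlucb_variant_def Let_def by blast

lemma sum_num_draws_run:
  assumes "mlucb_variant \<beta> R A" "fst \<omega> \<in> space R"
  shows "(\<Sum>p\<in>arms. num_draws (run A \<omega> t) p) = t"
proof (induction t)
  case (Suc t)
  then show ?case
    using next_arm_in_arms[OF assms, of "run A \<omega> t"] by (simp add: Let_def sum.distrib finite_arms)
qed simp

section \<open>Bounding the draws of an unstopped run\<close>

text \<open>The squared gap charged to each arm. For \<open>(2,2)\<close> two estimates are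
  available, one from the failed stopping test and one from its being the reply of action 2, whence
  the maximum.\<close>

definition gap_sq :: "(arm \<Rightarrow> real) \<Rightarrow> arm \<Rightarrow> real" where
  "gap_sq \<mu> p =
     (if p = (1, 2) then (\<mu> (1,2) - \<mu> (2,1))\<^sup>2
      else if p = (2, 2) then max ((\<mu> (1,1) - \<mu> (2,1))\<^sup>2) ((\<mu> (2,2) - \<mu> (2,1))\<^sup>2)
      else (\<mu> (1,1) - \<mu> (2,1))\<^sup>2)"

text \<open>Squaring four radii gives \<open>16 * b / (2 * n)\<close>, which is the origin of the
  factor 8 in the bound.\<close>

lemma le_radius_imp_draws_le:
  assumes "0 < d" "d \<le> 4 * sqrt (b / (2 * real n))" "0 \<le> b" "n > 0"
  shows "real n \<le> 8 * b / d\<^sup>2"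
proof -
  have "d\<^sup>2 \<le> (4 * sqrt (b / (2 * real n)))\<^sup>2"
    using assms by (intro power_mono) auto
  also have "\<dots> = 8 * b / n"
    using assms by (simp add: power_mult_distrib)
  finally show ?thesis
    using assms by (simp add: field_simps)
qed

lemma gap_sq_pos: "bandit_instance \<mu> \<Longrightarrow> \<mu> (2,1) < \<mu> (1,1) \<Longrightarrow> 0 < gap_sq \<mu> p"
  by (auto simp: gap_sq_def bandit_instance_def max_def)

text \<open>Let \<open>P = (1, c 1)\<close> and \<open>Q = (2, c 2)\<close> be the two candidates. Since the run goes on,
  \<open>L P\<close> is at most \<open>U Q\<close>, while \<open>L Q\<close> is at most \<open>L (2,1)\<close>; hence \<open>\<mu> P - \<mu> (2,1)\<close> is at most the sum of the widths of the two
  confidence intervals, that is, at most four times the radius of the less drawn of the two.\<close>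

lemma num_draws_next_arm_le:
  assumes A: "mlucb_variant \<beta> R A" "r \<in> space R"
    and \<mu>: "bandit_instance \<mu>" "\<mu> (2,1) < \<mu> (1,1)"
    and nonneg: "0 \<le> \<beta> (length h)"
    and go: "\<not> stop_cond \<beta> (mean0 A) h"
    and lower: "\<And>p. p \<in> arms \<Longrightarrow> lower_bound \<beta> (mean0 A) h p \<le> \<mu> p"
    and upper: "\<And>p. p \<in> arms \<Longrightarrow> \<mu> p \<le> upper_bound \<beta> (mean0 A) h p"
  shows "num_draws h (next_arm A r h) \<le> 8 * \<beta> (length h) / gap_sq \<mu> (next_arm A r h)"
proof (cases "num_draws h (next_arm A r h) = 0")
  case True
  then show ?thesis
    using nonneg gap_sq_pos[OF \<mu>, of "next_arm A r h"] by simp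
next
  case False
  define p where "p = next_arm A r h"
  define N where "N = num_draws h p"
  define L where "L = lower_bound \<beta> (mean0 A) h"
  define U where "U = upper_bound \<beta> (mean0 A) h"
  define rad where "rad = (\<lambda>q. sqrt (\<beta> (length h) / (2 * num_draws h q)))"
  obtain c where c: "\<forall>i\<in>{1, 2}. c i \<in> {1, 2}"
    and c_min: "\<forall>i\<in>{1, 2}. \<forall>j\<in>{1, 2}. L (i, c i) \<le> L (i, j)"
    and p_in: "p \<in> {(1, c 1), (2, c 2)}"
    and N_le: "\<forall>i\<in>{1, 2}. N \<le> num_draws h (i, c i)"
    using mlucb_variantE[OF A, of h] unfolding L_def N_def p_def by blast
  from p_in have p: "p = (1, c 1) \<or> p = (2, c 2)"
    by blast
  let ?P = "(1, c 1)" and ?Q = "(2, c 2)"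
  have N: "N > 0"
    using False by (simp add: N_def p_def)
  \<comment> \<open>The drawn arm is the less drawn candidate, so both candidates have been drawn
    and have finite confidence bounds.\<close>
  have drawn: "num_draws h ?P > 0" "num_draws h ?Q > 0"
    using N N_le by auto
  have arms: "?P \<in> arms" "?Q \<in> arms" "(2, 1) \<in> arms"
    using c by (auto simp: arms_def)
  have L: "L q = emp_mean (mean0 A) h q - rad q" and U: "U q = emp_mean (mean0 A) h q + rad q"
    if "num_draws h q > 0" for q
    using that by (simp_all add: L_def U_def lower_bound_def upper_bound_def rad_def)
  have rad_le: "rad q \<le> rad p" if "N \<le> num_draws h q" for q
    unfolding rad_def using that nonneg N
    by (intro real_sqrt_le_mono divide_left_mono) (auto simp: N_def)
  have radii: "rad ?P \<le> rad p" "rad ?Q \<le> rad p"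
    using N_le by (auto intro!: rad_le)
  have L_Q: "L ?Q \<le> \<mu> (2,1)"
    using c_min lower[OF arms(3)] by (auto simp: L_def intro: order.trans)
  have c_cases: "c 1 = 1 \<or> c 1 = 2" "c 2 = 1 \<or> c 2 = 2"
    using c by auto
  have "\<not> (MIN j\<in>{1, 2}. U (other_action 1, j)) < (MIN j\<in>{1, 2}. L (1, j))"
    using go unfolding stop_cond_iff L_def U_def by blast
  then have "min (L (1, 1)) (L (1, 2)) \<le> min (U (2, 1)) (U (2, 2))"
    unfolding MIN_actions not_less by (simp only: other_action_def refl if_True)
  moreover have "L ?P \<le> min (L (1, 1)) (L (1, 2))"
    using c_min by simp
  moreover have "min (U (2, 1)) (U (2, 2)) \<le> U ?Q"
    using c_cases(2) by (metis min.cobounded1 min.cobounded2)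
  ultimately have "L ?P \<le> U ?Q"
    by order
  moreover have "\<mu> ?P \<le> U ?P"
    using upper[OF arms(1)] by (simp add: U_def)
  ultimately have "\<mu> ?P - \<mu> (2,1) \<le> 2 * rad ?P + 2 * rad ?Q"
    using L_Q L[OF drawn(1)] U[OF drawn(1)] L[OF drawn(2)] U[OF drawn(2)] by simp
  then have gap_P: "\<mu> ?P - \<mu> (2,1) \<le> 4 * rad p"
    using radii by simp
  \<comment> \<open>The second estimate uses only that \<open>?Q\<close> minimises \<open>L\<close>
    within action 2: its interval reaches down to \<open>\<mu> (2,1)\<close>. For
    \<open>?Q = (2,2)\<close> this bounds the gap inside action 2.\<close>
  have "\<mu> ?Q \<le> U ?Q"
    using upper[OF arms(2)] by (simp add: U_def)
  then have "\<mu> ?Q - \<mu> (2,1) \<le> 2 * rad ?Q"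
    using L_Q L[OF drawn(2)] U[OF drawn(2)] by simp
  moreover have "0 \<le> rad p"
    using nonneg by (simp add: rad_def)
  ultimately have gap_Q: "\<mu> ?Q - \<mu> (2,1) \<le> 4 * rad p"
    using radii by simp
  have bound: "N \<le> 8 * \<beta> (length h) / d\<^sup>2" if "0 < d" "d \<le> 4 * rad p" for d
    using le_radius_imp_draws_le[of d "\<beta> (length h)" N] that nonneg N by (simp add: rad_def N_def)
  have order: "\<mu> (1,1) \<le> \<mu> (1,2)" "\<mu> (2,1) \<le> \<mu> (2,2)"
    using \<mu>(1) by (auto simp: bandit_instance_def)
  have gap: "\<mu> (1,1) - \<mu> (2,1) \<le> 4 * rad p"
    using gap_P order c_cases(1) by auto
  have "N \<le> 8 * \<beta> (length h) / gap_sq \<mu> p"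
  \<comment> \<open>Only in this case does the gap inside action 2 decide the maximum, and
    \<open>gap_Q\<close> applies. Otherwise \<open>gap_P\<close> serves \<open>(1,2)\<close>, and
    its weakening \<open>gap\<close> serves the rest.\<close>
  proof (cases "p = (2, 2) \<and> (\<mu> (1,1) - \<mu> (2,1))\<^sup>2 < (\<mu> (2,2) - \<mu> (2,1))\<^sup>2")
    case True
    then have "0 < \<mu> (2,2) - \<mu> (2,1)"
      using order by (cases "\<mu> (2,2) = \<mu> (2,1)") auto
    moreover have "\<mu> (2,2) - \<mu> (2,1) \<le> 4 * rad p"
      using gap_Q True p by auto
    ultimately show ?thesis
      using bound True by (auto simp: gap_sq_def max_def)
  next
    case False
    show ?thesis
    proof (cases "p = (1, 2)")
      case True
      then show ?thesis
        using bound[of "\<mu> (1,2) - \<mu> (2,1)"] gap_P p \<mu>(2) order by (auto simp: gap_sq_def)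
    next
      case False': False
      show ?thesis
        using bound[OF _ gap] False False' \<mu>(2) by (auto simp: gap_sq_def max_def)
    qed
  qed
  then show ?thesis
    by (simp add: N_def p_def)
qed

text \<open>The length of a run is the sum of the draws of the arms. From round \<open>w\<close> on,
  an arm is drawn only while its count is below the bound of \<open>num_draws_next_arm_le\<close>;
  earlier draws are charged to \<open>w\<close>.\<close>

lemma run_length_le:
  fixes w t :: nat
  assumes A: "mlucb_variant \<beta> R A" "fst \<omega> \<in> space R"
    and \<mu>: "bandit_instance \<mu>" "\<mu> (2,1) < \<mu> (1,1)"
    and \<beta>: "0 \<le> \<beta> 0" "mono \<beta>"
    and go: "\<And>s. s < t \<Longrightarrow> \<not> stop_cond \<beta> (mean0 A) (run A \<omega> s)"
    and lower: "\<And>s p. w \<le> s \<Longrightarrow> p \<in> arms \<Longrightarrow> lower_bound \<beta> (mean0 A) (run A \<omega> s) p \<le> \<mu> p"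
    and upper: "\<And>s p. w \<le> s \<Longrightarrow> p \<in> arms \<Longrightarrow> \<mu> p \<le> upper_bound \<beta> (mean0 A) (run A \<omega> s) p"
  shows "real t \<le> real w + 4 + (\<Sum>p\<in>arms. 8 / gap_sq \<mu> p) * \<beta> t"
proof -
  have nonneg: "0 \<le> \<beta> s" for s
    using \<beta> monoD[OF \<beta>(2), of 0 s] by simp
  \<comment> \<open>\<open>min w s\<close> freezes the count of early draws at round
    \<open>w\<close>. The added 1 pays for the draw made while the count was still within the
    bound.\<close>
  have draws: "real (num_draws (run A \<omega> s) p) \<le> real (num_draws (run A \<omega> (min w s)) p) + (8 * \<beta> s / gap_sq \<mu> p + 1)"
    (is "_ \<le> _ + ?b s p") if "s \<le> t" for s p
    using that
  proof (induction s)
    case 0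
    show ?case
      using nonneg gap_sq_pos[OF \<mu>, of p] by simp
  next
    case (Suc s)
    have mono: "?b s p \<le> ?b (Suc s) p"
      using monoD[OF \<beta>(2), of s "Suc s"] gap_sq_pos[OF \<mu>, of p] by (simp add: divide_right_mono)
    show ?case
    proof (cases "s < w")
      case True
      then have "min w (Suc s) = Suc s"
        by simp
      then show ?thesis
        using nonneg[of "Suc s"] gap_sq_pos[OF \<mu>, of p] by simp
    next
      case False
      then have w: "min w (Suc s) = w" "min w s = w"
        by auto
      show ?thesis
      proof (cases "next_arm A (fst \<omega>) (run A \<omega> s) = p")
        case True
        have "num_draws (run A \<omega> s) (next_arm A (fst \<omega>) (run A \<omega> s))
            \<le> 8 * \<beta> (length (run A \<omega> s)) / gap_sq \<mu> (next_arm A (fst \<omega>) (run A \<omega> s))"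
        proof (rule num_draws_next_arm_le[OF A \<mu>])
          show "0 \<le> \<beta> (length (run A \<omega> s))"
            by (rule nonneg)
          show "\<not> stop_cond \<beta> (mean0 A) (run A \<omega> s)"
            using Suc.prems by (intro go) simp
        qed (use False in \<open>auto intro: lower upper\<close>)
        then have "num_draws (run A \<omega> s) p \<le> 8 * \<beta> s / gap_sq \<mu> p"
          by (simp only: True length_run)
        then show ?thesis
          using mono True by (simp add: Let_def)
      next
        case False
        then show ?thesis
          using mono Suc by (simp add: Let_def w)
      qed
    qed
  qed
  have "real t = (\<Sum>p\<in>arms. real (num_draws (run A \<omega> t) p))"
    unfolding of_nat_sum[symmetric] sum_num_draws_run[OF A] ..
  also have "\<dots> \<le> (\<Sum>p\<in>arms. num_draws (run A \<omega> (min w t)) p + ?b t p)"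
    using draws by (intro sum_mono) simp
  also have "\<dots> = real (\<Sum>p\<in>arms. num_draws (run A \<omega> (min w t)) p) + (4 + (\<Sum>p\<in>arms. 8 / gap_sq \<mu> p) * \<beta> t)"
    by (simp add: sum.distrib sum_distrib_right card_arms)
  \<comment> \<open>The early draws of all arms together make up \<open>min w t\<close> rounds, so
    \<open>w\<close> is paid once and not once per arm.\<close>
  also have "(\<Sum>p\<in>arms. num_draws (run A \<omega> (min w t)) p) = min w t"
    by (rule sum_num_draws_run[OF A])
  finally show ?thesis
    by simp
qed

subsection \<open>Measurability\<close>

lemma bandit_measure_eq: "bandit_measure R \<mu> = R \<Otimes>\<^sub>M reward_table \<mu>"
  by (simp add: bandit_measure_def reward_table_def)

lemma prob_space_bandit_measure:
  assumes "prob_space R"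
  shows "prob_space (bandit_measure R \<mu>)"
proof -
  interpret R: prob_space R by fact
  interpret T: prob_space "reward_table \<mu>" by (rule prob_space_reward_table)
  interpret pair_prob_space R "reward_table \<mu>" ..
  show ?thesis
    unfolding bandit_measure_eq by (rule prob_space_axioms)
qed

text \<open>Transfers statements about the rewards alone to full outcomes, by integrating out the
  seed.\<close>

lemma distr_snd_bandit_measure:
  assumes "prob_space R"
  shows "distr (bandit_measure R \<mu>) (reward_table \<mu>) snd = reward_table \<mu>"
proof -
  interpret R: prob_space R by fact
  interpret T: prob_space "reward_table \<mu>" by (rule prob_space_reward_table)
  interpret pair_prob_space R "reward_table \<mu>" ..
  show ?thesis
  proof (rule measure_eqI)
    fix E assume "E \<in> sets (distr (bandit_measure R \<mu>) (reward_table \<mu>) snd)"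
    then have E: "E \<in> sets (reward_table \<mu>)"
      by simp
    then have "snd -` E \<inter> space (R \<Otimes>\<^sub>M reward_table \<mu>) = space R \<times> E"
      using sets.sets_into_space by (fastforce simp: space_pair_measure)
    with E show "emeasure (distr (bandit_measure R \<mu>) (reward_table \<mu>) snd) E = emeasure (reward_table \<mu>) E"
      by (simp add: bandit_measure_eq emeasure_distr T.emeasure_pair_measure_Times R.emeasure_space_1)
  qed simp
qed

lemma snd_measurable_bandit [measurable]: "snd \<in> bandit_measure R \<mu> \<rightarrow>\<^sub>M reward_table \<mu>"
  by (simp add: bandit_measure_eq)

lemma fst_measurable_bandit [measurable]: "fst \<in> bandit_measure R \<mu> \<rightarrow>\<^sub>M R"
  by (simp add: bandit_measure_eq)

text \<open>Histories and arms form countable types, so a map that is measurable for each fixed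
  history and arm stays measurable when these are random. The induction step uses this first for the
  next arm, then for the past.\<close>

lemma measurable_run [measurable]:
  assumes A: "mlucb_variant \<beta> R A"
  shows "(\<lambda>\<omega>. run A \<omega> t) \<in> bandit_measure R \<mu> \<rightarrow>\<^sub>M count_space UNIV"
proof (induction t)
  case (Suc t)
  have [measurable]: "(\<lambda>r. next_arm A r h) \<in> R \<rightarrow>\<^sub>M count_space UNIV" for h
    using A by (simp add: mlucb_variant_def)
  have next_arm: "(\<lambda>\<omega>. next_arm A (fst \<omega>) h) \<in> bandit_measure R \<mu> \<rightarrow>\<^sub>M count_space UNIV" for h
    by measurable
  have reward: "(\<lambda>\<omega>. h @ [(p, snd \<omega> (p, num_draws h p))]) \<in> bandit_measure R \<mu> \<rightarrow>\<^sub>M count_space UNIV" for h p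
    by measurable
  let ?step = "\<lambda>h p \<omega>. h @ [(p, snd \<omega> (p, num_draws h p))]"
  have "(\<lambda>\<omega>. ?step h (next_arm A (fst \<omega>) h) \<omega>) \<in> bandit_measure R \<mu> \<rightarrow>\<^sub>M count_space UNIV" for h
    by (rule measurable_compose_countable[where f = "?step h"]) (rule reward next_arm)+
  then have "(\<lambda>\<omega>. ?step (run A \<omega> t) (next_arm A (fst \<omega>) (run A \<omega> t)) \<omega>)
      \<in> bandit_measure R \<mu> \<rightarrow>\<^sub>M count_space UNIV"
    by (rule measurable_compose_countable[where f = "\<lambda>h \<omega>. ?step h (next_arm A (fst \<omega>) h) \<omega>", OF _ Suc])
  then show ?case
    unfolding run.simps Let_def .
qed simp

section \<open>The stopping time as a first hitting time\<close>

lemma stopping_time_eq_enat_iff: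
  "stopping_time \<beta> A \<omega> = enat t \<longleftrightarrow>
     stop_cond \<beta> (mean0 A) (run A \<omega> t) \<and> (\<forall>s<t. \<not> stop_cond \<beta> (mean0 A) (run A \<omega> s))"
proof -
  define S where "S = {enat t | t. stop_cond \<beta> (mean0 A) (run A \<omega> t)}"
  have S: "stopping_time \<beta> A \<omega> = Inf S"
    by (simp add: stopping_time_def S_def)
  have "Inf S = enat t \<longleftrightarrow> enat t \<in> S \<and> (\<forall>s<t. enat s \<notin> S)"
  proof
    assume eq: "Inf S = enat t"
    then have "S \<noteq> {}"
      by (auto simp: Inf_enat_def)
    then have "Inf S \<in> S"
      unfolding Inf_enat_def by (auto intro: LeastI)
    moreover have "enat s \<notin> S" if "s < t" for s
      using eq that Inf_lower[of "enat s" S] by auto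
    ultimately show "enat t \<in> S \<and> (\<forall>s<t. enat s \<notin> S)"
      using eq by auto
  next
    assume "enat t \<in> S \<and> (\<forall>s<t. enat s \<notin> S)"
    then show "Inf S = enat t"
      by (intro antisym Inf_lower Inf_greatest) (auto simp: S_def not_less[symmetric])
  qed
  then show ?thesis
    unfolding S by (simp add: S_def)
qed

lemma ex_stopping_time:
  assumes "stop_cond \<beta> (mean0 A) (run A \<omega> t)"
  obtains s where "stopping_time \<beta> A \<omega> = enat s"
proof -
  define s where "s = (LEAST s. stop_cond \<beta> (mean0 A) (run A \<omega> s))"
  have "stopping_time \<beta> A \<omega> = enat s"
    unfolding stopping_time_eq_enat_iff s_def using assms by (metis LeastI not_less_Least)
  then show thesis
    by (rule that)
qed

text \<open>A bound on unstopped runs also yields termination: a run that never stops would make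
  \<open>T\<close> an upper bound of all natural numbers.\<close>

lemma stopping_time_le:
  assumes "\<And>t. (\<And>s. s < t \<Longrightarrow> \<not> stop_cond \<beta> (mean0 A) (run A \<omega> s)) \<Longrightarrow> real t \<le> T"
  obtains s where "stopping_time \<beta> A \<omega> = enat s" "real s \<le> T"
proof -
  have "\<exists>t. stop_cond \<beta> (mean0 A) (run A \<omega> t)"
  proof (rule ccontr)
    assume "\<not> (\<exists>t. stop_cond \<beta> (mean0 A) (run A \<omega> t))"
    then have "real t \<le> T" for t
      using assms by blast
    then show False
      using reals_Archimedean2[of T] by (metis not_less)
  qed
  then obtain s where s: "stopping_time \<beta> A \<omega> = enat s"
    using ex_stopping_time by blast
  then have "real s \<le> T"
    by (intro assms) (simp add: stopping_time_eq_enat_iff)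
  with s show thesis
    by (rule that)
qed

lemma correct_event_measurable:
  assumes A: "mlucb_variant \<beta> R A"
  shows "correct_event R \<mu> \<beta> A \<in> sets (bandit_measure R \<mu>)"
proof -
  have [measurable]: "(\<lambda>r. best_action A r h) \<in> R \<rightarrow>\<^sub>M count_space UNIV" for h
    using A by (simp add: mlucb_variant_def)
  note [measurable] = measurable_run[OF A]
  have best: "(\<lambda>\<omega>. best_action A (fst \<omega>) h) \<in> bandit_measure R \<mu> \<rightarrow>\<^sub>M count_space UNIV" for h
    by measurable
  have [measurable]: "(\<lambda>\<omega>. stop_cond \<beta> (mean0 A) (run A \<omega> t)) \<in> bandit_measure R \<mu> \<rightarrow>\<^sub>M count_space UNIV" for t
    by (rule measurable_compose[OF measurable_run[OF A]]) simp
  have [measurable]: "(\<lambda>\<omega>. \<mu> (1,1) - \<mu> (best_action A (fst \<omega>) (run A \<omega> t), 1) \<le> 0)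
      \<in> bandit_measure R \<mu> \<rightarrow>\<^sub>M count_space UNIV" for t
    by (rule measurable_compose_countable[where f = "\<lambda>h \<omega>. \<mu> (1,1) - \<mu> (best_action A (fst \<omega>) h, 1) \<le> 0",
          OF _ measurable_run[OF A]])
       (rule measurable_compose[OF best], simp)
  show ?thesis
    unfolding correct_event_def stopping_time_eq_enat_iff by measurable
qed

section \<open>What stopping implies for the draws and the recommendation\<close>

text \<open>Stopping needs finite lower bounds for both arms of some action, so at least two arms
  have been drawn. The round gained here lets the later union bound start at round 2, in line with a
  series in \<open>C\<close> whose term at 1 vanishes.\<close>

lemma num_draws_less_length_if_stop:
  assumes "stop_cond \<beta> v h"
  shows "num_draws h p < length h"
proof -
  obtain i where i: "(MIN j\<in>{1, 2}. upper_bound \<beta> v h (other_action i, j)) <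
      (MIN j\<in>{1, 2}. lower_bound \<beta> v h (i, j))"
    using assms unfolding stop_cond_iff by blast
  then have "- \<infinity> < min (lower_bound \<beta> v h (i, 1)) (lower_bound \<beta> v h (i, 2))"
    unfolding MIN_actions using ereal_infty_less_eq2(2) ereal_MInfty_lessI by fastforce
  then have "num_draws h (i, 1) > 0" "num_draws h (i, 2) > 0"
    by (auto simp: lower_bound_def split: if_splits)
  moreover have "p \<noteq> (i, 1) \<or> p \<noteq> (i, 2)"
    by auto
  ultimately obtain q where "p \<noteq> q" "num_draws h q > 0"
    by blast
  then show ?thesis
    using num_draws_add_le_length[of p q h] by simp
qed

text \<open>The valid bounds give \<open>L (2,1) < U (1,j)\<close> for both \<open>j\<close>, so the
  run cannot have stopped in favour of action 2. Stopping in favour of action 1 separates the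
  intervals, and the empirical means inside them are separated too.\<close>

lemma best_action_eq_1:
  assumes A: "mlucb_variant \<beta> R A" "r \<in> space R"
    and \<mu>: "bandit_instance \<mu>" "\<mu> (2,1) < \<mu> (1,1)"
    and nonneg: "0 \<le> \<beta> (length h)"
    and stop: "stop_cond \<beta> (mean0 A) h"
    and upper: "\<And>j. j \<in> {1, 2} \<Longrightarrow> \<mu> (1, j) \<le> upper_bound \<beta> (mean0 A) h (1, j)"
    and lower: "lower_bound \<beta> (mean0 A) h (2, 1) \<le> \<mu> (2, 1)"
  shows "best_action A r h = 1"
proof -
  define m where "m = (\<lambda>p. ereal (emp_mean (mean0 A) h p))"
  define L where "L = lower_bound \<beta> (mean0 A) h"
  define U where "U = upper_bound \<beta> (mean0 A) h"
  \<comment> \<open>This includes undrawn arms, whose arbitrary mean lies between infinite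
    bounds.\<close>
  have m: "L p \<le> m p" "m p \<le> U p" for p
    using nonneg by (auto simp: L_def U_def m_def lower_bound_def upper_bound_def)
  have "\<mu> (1,1) \<le> \<mu> (1,2)"
    using \<mu>(1) by (simp add: bandit_instance_def)
  then have "ereal (\<mu> (1,1)) \<le> U (1, 2)" "ereal (\<mu> (1,1)) \<le> U (1, 1)"
    using upper[of 1] upper[of 2] order.trans[of "ereal (\<mu> (1,1))" "ereal (\<mu> (1,2))" "U (1, 2)"]
    by (auto simp: U_def)
  moreover have "L (2,1) < ereal (\<mu> (1,1))"
    using lower \<mu>(2) le_less_trans[of "L (2,1)" "ereal (\<mu> (2,1))" "ereal (\<mu> (1,1))"]
    by (auto simp: L_def)
  ultimately have "L (2,1) < min (U (1,1)) (U (1,2))"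
    by (auto intro: less_le_trans)
  then have "\<not> min (U (1,1)) (U (1,2)) < min (L (2,1)) (L (2,2))"
    by (auto simp: not_less intro: min.coboundedI1)
  then have "min (U (2,1)) (U (2,2)) < min (L (1,1)) (L (1,2))"
    using stop unfolding stop_cond_iff MIN_actions L_def U_def by (auto simp: other_action_def)
  moreover have "min (m (2,1)) (m (2,2)) \<le> min (U (2,1)) (U (2,2))"
    by (intro min.mono m)
  moreover have "min (L (1,1)) (L (1,2)) \<le> min (m (1,1)) (m (1,2))"
    by (intro min.mono m)
  ultimately have "min (m (2,1)) (m (2,2)) < min (m (1,1)) (m (1,2))"
    by order
  then have "min (emp_mean (mean0 A) h (2,1)) (emp_mean (mean0 A) h (2,2)) <
      min (emp_mean (mean0 A) h (1,1)) (emp_mean (mean0 A) h (1,2))"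
    by (simp only: m_def ereal_min[symmetric] less_ereal.simps)
  then show ?thesis
    using best_action_arg_max[OF A, of h] unfolding is_arg_max_def MIN_actions
    by (auto simp del: One_nat_def)
qed

subsection \<open>The burn-in time\<close>

text \<open>A default value due to \<open>ln 0 = 0\<close>. For \<open>C \<ge> 1\<close> it fits
  below all later rates, so monotonicity holds from round 0.\<close>

lemma exploration_rate_0 [simp]: "exploration_rate \<alpha> C \<delta> 0 = 0"
  by (simp add: exploration_rate_def)

lemma exploration_rate_eq:
  assumes "0 < C" "0 < \<delta>" "0 < t"
  shows "exploration_rate \<alpha> C \<delta> t = ln (1 / \<delta>) + ln C + (1 + \<alpha>) * ln (real t)"
  using assms by (simp add: exploration_rate_def ln_mult ln_div ln_powr)

text \<open>Hoeffding's bound at this rate: a summable power of the round, weighted by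
  \<open>\<delta> / C\<close>.\<close>

lemma exp_minus_exploration_rate:
  assumes "0 < C" "0 < \<delta>" "0 < t"
  shows "exp (- exploration_rate \<alpha> C \<delta> t) = \<delta> / C * real t powr - (1 + \<alpha>)"
  using assms unfolding powr_minus by (simp add: exploration_rate_def exp_minus divide_simps)

lemma mono_exploration_rate:
  assumes "1 \<le> C" "0 < \<delta>" "\<delta> \<le> 1" "0 \<le> \<alpha>"
  shows "mono (exploration_rate \<alpha> C \<delta>)"
proof (rule monoI)
  fix s t :: nat assume st: "s \<le> t"
  show "exploration_rate \<alpha> C \<delta> s \<le> exploration_rate \<alpha> C \<delta> t"
  proof (cases "t = 0")
    case False
    then have t: "0 \<le> ln (1 / \<delta>)" "0 \<le> ln C" "0 \<le> (1 + \<alpha>) * ln (real t)"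
      using assms by auto
    show ?thesis
    proof (cases "s = 0")
      case True
      then show ?thesis
        using t assms False by (simp add: exploration_rate_eq)
    next
      case False
      then have "ln (real s) \<le> ln (real t)"
        using st by simp
      then have "(1 + \<alpha>) * ln (real s) \<le> (1 + \<alpha>) * ln (real t)"
        using assms by (intro mult_left_mono) auto
      then show ?thesis
        using assms False st by (simp add: exploration_rate_eq)
    qed
  qed (use st in simp)
qed

lemma exploration_rate_nonneg:
  assumes "1 \<le> C" "0 < \<delta>" "\<delta> \<le> 1" "0 \<le> \<alpha>"
  shows "0 \<le> exploration_rate \<alpha> C \<delta> t"
  using monoD[OF mono_exploration_rate[OF assms], of 0 t] by simp

lemma exploration_rate_antimono:
  assumes "0 < C" "0 < \<delta>" "\<delta> \<le> \<delta>'"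
  shows "exploration_rate \<alpha> C \<delta>' t \<le> exploration_rate \<alpha> C \<delta> t"
proof (cases "t = 0")
  case False
  then show ?thesis
    using assms by (simp add: exploration_rate_eq ln_div)
qed simp

text \<open>The premise is conditional because an undrawn arm has lower bound
  \<open>-\<infinity>\<close>; \<open>upper_bound_run_ge\<close> is the mirror image.\<close>

lemma lower_bound_run_le:
  assumes "num_draws (run A \<omega> t) p > 0 \<Longrightarrow>
     table_mean (snd \<omega>) p (num_draws (run A \<omega> t) p) \<le>
       m + sqrt (\<beta> t / (2 * real (num_draws (run A \<omega> t) p)))"
  shows "lower_bound \<beta> v (run A \<omega> t) p \<le> ereal m"
  using assms by (cases "num_draws (run A \<omega> t) p = 0") (auto simp: lower_bound_def emp_mean_run)

lemma upper_bound_run_ge: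
  assumes "num_draws (run A \<omega> t) p > 0 \<Longrightarrow>
     m - sqrt (\<beta> t / (2 * real (num_draws (run A \<omega> t) p))) \<le>
       table_mean (snd \<omega>) p (num_draws (run A \<omega> t) p)"
  shows "ereal m \<le> upper_bound \<beta> v (run A \<omega> t) p"
  using assms by (cases "num_draws (run A \<omega> t) p = 0") (auto simp: upper_bound_def emp_mean_run)

text \<open>The rate is smallest at \<open>\<delta> = 1\<close>, so that a single event serves every \<open>\<delta>\<close>.
  The maximum with \<open>k\<close> makes the failure probabilities summable over \<open>k\<close> when \<open>\<alpha> > 1\<close>, and yet
  is harmless in every round \<open>t \<ge> k\<close>, because an arm is drawn at most \<open>t\<close> times in \<open>t\<close> rounds.\<close>

definition concentrated :: "real \<Rightarrow> real \<Rightarrow> (arm \<Rightarrow> real) \<Rightarrow> nat \<Rightarrow> (arm \<times> nat \<Rightarrow> bool) \<Rightarrow> bool" where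
  "concentrated \<alpha> C \<mu> k y \<longleftrightarrow>
     (\<forall>n. \<forall>p\<in>arms. \<bar>table_mean y p (Suc n) - \<mu> p\<bar>
            < sqrt (exploration_rate \<alpha> C 1 (max (Suc n) k) / (2 * real (Suc n))))"

lemma concentratedD:
  assumes conc: "concentrated \<alpha> C \<mu> k y" and p: "p \<in> arms" and n: "0 < n" "n \<le> t" "k \<le> t"
    and C: "1 \<le> C" "0 \<le> \<alpha>" and \<delta>: "0 < \<delta>" "\<delta> \<le> 1"
  shows "\<bar>table_mean y p n - \<mu> p\<bar> \<le> sqrt (exploration_rate \<alpha> C \<delta> t / (2 * real n))"
proof -
  have "exploration_rate \<alpha> C 1 (max n k) \<le> exploration_rate \<alpha> C 1 t"
    using C n by (intro monoD[OF mono_exploration_rate]) auto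
  also have "\<dots> \<le> exploration_rate \<alpha> C \<delta> t"
    using C \<delta> by (intro exploration_rate_antimono) auto
  finally have "sqrt (exploration_rate \<alpha> C 1 (max n k) / (2 * real n)) \<le> sqrt (exploration_rate \<alpha> C \<delta> t / (2 * real n))"
    by (intro real_sqrt_le_mono divide_right_mono) simp_all
  moreover have "\<bar>table_mean y p n - \<mu> p\<bar> < sqrt (exploration_rate \<alpha> C 1 (max n k) / (2 * real n))"
    using conc p n(1) by (cases n) (auto simp: concentrated_def)
  ultimately show ?thesis
    by linarith
qed

lemma measurable_concentrated [measurable]:
  "Measurable.pred (reward_table \<mu>') (concentrated \<alpha> C \<mu> k)"
  unfolding concentrated_def using countable_finite[OF finite_arms] by measurable

text \<open>The maximum dominates both arguments, so each may take half of the exponent. With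
  \<open>a = 1 + \<alpha>\<close> the failure bound factorises in \<open>n\<close> and
  \<open>k\<close>, and both halves exceed 1 because \<open>\<alpha> > 1\<close>.\<close>

lemma powr_max_le:
  fixes x y a :: real
  assumes "0 < x" "0 < y" "0 \<le> a"
  shows "max x y powr - a \<le> x powr - (a / 2) * y powr - (a / 2)"
proof -
  have "max x y powr - a = max x y powr - (a / 2) * max x y powr - (a / 2)"
    by (simp flip: powr_add)
  also have "\<dots> \<le> x powr - (a / 2) * y powr - (a / 2)"
    using assms by (intro mult_mono powr_mono2') auto
  finally show ?thesis .
qed

text \<open>A union bound over the number of draws, the arms and the two sides. Summing over
  \<open>n\<close> leaves a power of \<open>k\<close> that is again summable.\<close>

lemma emeasure_not_concentrated_le:
  assumes \<mu>: "\<And>p. p \<in> arms \<Longrightarrow> 0 \<le> \<mu> p \<and> \<mu> p \<le> 1" and C: "1 \<le> C" "1 < \<alpha>"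
  defines "q \<equiv> (1 + \<alpha>) / 2"
  shows "emeasure (reward_table \<mu>) {y\<in>space (reward_table \<mu>). \<not> concentrated \<alpha> C \<mu> (Suc k) y}
           \<le> ennreal (8 / C * (\<Sum>n. real (Suc n) powr - q) * real (Suc k) powr - q)"
proof -
  interpret prob_space "reward_table \<mu>" by (rule prob_space_reward_table)
  define r where "r = (\<lambda>n. sqrt (exploration_rate \<alpha> C 1 (max (Suc n) (Suc k)) / (2 * real (Suc n))))"
  define Up where "Up = (\<lambda>n p. {y\<in>space (reward_table \<mu>). table_mean y p (Suc n) \<ge> \<mu> p + r n})"
  define Lo where "Lo = (\<lambda>n p. {y\<in>space (reward_table \<mu>). table_mean y p (Suc n) \<le> \<mu> p - r n})"
  have [measurable]: "Up n p \<in> events" "Lo n p \<in> events" for n p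
    unfolding Up_def Lo_def by measurable
  \<comment> \<open>The 8 counts four arms with two sides each.\<close>
  let ?b = "\<lambda>n. 8 / C * real (Suc n) powr - q * real (Suc k) powr - q"
  have bound: "measure (reward_table \<mu>) (\<Union>p\<in>arms. Up n p \<union> Lo n p) \<le> ?b n" for n
  proof -
    let ?e = "exp (- exploration_rate \<alpha> C 1 (max (Suc n) (Suc k)))"
    have "measure (reward_table \<mu>) (Up n p \<union> Lo n p) \<le> 2 * ?e" if "p \<in> arms" for p
    proof -
      have "0 \<le> exploration_rate \<alpha> C 1 (max (Suc n) (Suc k))"
        using C by (intro exploration_rate_nonneg) auto
      then have "measure (reward_table \<mu>) (Up n p) \<le> ?e" "measure (reward_table \<mu>) (Lo n p) \<le> ?e"
        unfolding Up_def Lo_def r_def using \<mu>[OF that] that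
        by (auto intro!: Hoeffding_table_mean simp del: of_nat_Suc)
      moreover have "measure (reward_table \<mu>) (Up n p \<union> Lo n p)
          \<le> measure (reward_table \<mu>) (Up n p) + measure (reward_table \<mu>) (Lo n p)"
        by (intro measure_Un_le) auto
      ultimately show ?thesis
        by simp
    qed
    then have "(\<Sum>p\<in>arms. measure (reward_table \<mu>) (Up n p \<union> Lo n p)) \<le> (\<Sum>p\<in>arms. 2 * ?e)"
      by (rule sum_mono)
    moreover have "measure (reward_table \<mu>) (\<Union>p\<in>arms. Up n p \<union> Lo n p)
        \<le> (\<Sum>p\<in>arms. measure (reward_table \<mu>) (Up n p \<union> Lo n p))"
      by (intro finite_measure_subadditive_finite finite_arms image_subsetI) measurable
    ultimately have "measure (reward_table \<mu>) (\<Union>p\<in>arms. Up n p \<union> Lo n p) \<le> 8 * ?e"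
      by (simp add: card_arms)
    also have "?e = 1 / C * max (real (Suc n)) (real (Suc k)) powr - (1 + \<alpha>)"
      using C by (subst exp_minus_exploration_rate) (auto simp: of_nat_max)
    also have "8 * \<dots> \<le> 8 * (1 / C * (real (Suc n) powr - q * real (Suc k) powr - q))"
      unfolding q_def using C by (intro mult_left_mono powr_max_le) auto
    finally show ?thesis
      by (simp add: mult.assoc)
  qed
  have "summable (\<lambda>n. real n powr - q)"
    using C by (simp add: summable_real_powr_iff q_def)
  then have summable: "summable (\<lambda>n. real (Suc n) powr - q)"
    by (subst summable_Suc_iff)
  have "{y\<in>space (reward_table \<mu>). \<not> concentrated \<alpha> C \<mu> (Suc k) y} \<subseteq> (\<Union>n. \<Union>p\<in>arms. Up n p \<union> Lo n p)"
  proof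
    fix y assume y: "y \<in> {y\<in>space (reward_table \<mu>). \<not> concentrated \<alpha> C \<mu> (Suc k) y}"
    then obtain n p where p: "p \<in> arms" and "r n \<le> \<bar>table_mean y p (Suc n) - \<mu> p\<bar>"
      unfolding concentrated_def r_def not_less[symmetric] by blast
    then have "\<mu> p + r n \<le> table_mean y p (Suc n) \<or> table_mean y p (Suc n) \<le> \<mu> p - r n"
      by linarith
    then have "y \<in> Up n p \<union> Lo n p"
      using y by (simp add: Up_def Lo_def)
    with p show "y \<in> (\<Union>n. \<Union>p\<in>arms. Up n p \<union> Lo n p)"
      by blast
  qed
  then have "emeasure (reward_table \<mu>) {y\<in>space (reward_table \<mu>). \<not> concentrated \<alpha> C \<mu> (Suc k) y}
      \<le> emeasure (reward_table \<mu>) (\<Union>n. \<Union>p\<in>arms. Up n p \<union> Lo n p)"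
    using countable_finite[OF finite_arms] by (intro emeasure_mono) measurable
  also have "\<dots> \<le> (\<Sum>n. emeasure (reward_table \<mu>) (\<Union>p\<in>arms. Up n p \<union> Lo n p))"
    using finite_arms by (intro emeasure_subadditive_countably) auto
  also have "\<dots> \<le> (\<Sum>n. ennreal (?b n))"
    using bound by (intro suminf_le) (auto simp: emeasure_eq_measure intro!: ennreal_leI)
  also have "\<dots> = ennreal (\<Sum>n. ?b n)"
    using C by (intro suminf_ennreal2 summable_mult2 summable_mult summable) auto
  also have "(\<Sum>n. ?b n) = 8 / C * (\<Sum>n. real (Suc n) powr - q) * real (Suc k) powr - q"
    by (simp only: suminf_mult2[symmetric] suminf_mult[symmetric] summable summable_mult)
  finally show ?thesis .
qed

text \<open>An integrable upper bound on the first \<open>w\<close> for which \<open>concentrated\<close> holds at \<open>w + 1\<close>.\<close>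

definition burn_in :: "real \<Rightarrow> real \<Rightarrow> (arm \<Rightarrow> real) \<Rightarrow> (arm \<times> nat \<Rightarrow> bool) \<Rightarrow> ennreal" where
  "burn_in \<alpha> C \<mu> y = (\<Sum>k. indicator {y. \<not> concentrated \<alpha> C \<mu> (Suc k) y} y)"

lemma measurable_burn_in [measurable]: "burn_in \<alpha> C \<mu> \<in> borel_measurable (reward_table \<mu>')"
  unfolding burn_in_def by measurable

text \<open>The integral of the series is the series of failure probabilities, which is dominated by
  a convergent power series with exponent \<open>q > 1\<close>.\<close>

lemma nn_integral_burn_in_finite:
  assumes \<mu>: "\<And>p. p \<in> arms \<Longrightarrow> 0 \<le> \<mu> p \<and> \<mu> p \<le> 1" and C: "1 \<le> C" "1 < \<alpha>"
  shows "(\<integral>\<^sup>+ y. burn_in \<alpha> C \<mu> y \<partial>reward_table \<mu>) < \<infinity>"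
proof -
  define q where "q = (1 + \<alpha>) / 2"
  define S where "S = (\<Sum>n. real (Suc n) powr - q)"
  have "summable (\<lambda>n. real n powr - q)"
    using C by (simp add: summable_real_powr_iff q_def)
  then have summable: "summable (\<lambda>n. real (Suc n) powr - q)"
    by (subst summable_Suc_iff)
  then have "0 \<le> S"
    unfolding S_def by (intro suminf_nonneg) auto
  have "(\<integral>\<^sup>+ y. burn_in \<alpha> C \<mu> y \<partial>reward_table \<mu>) =
      (\<Sum>k. \<integral>\<^sup>+ y. indicator {y. \<not> concentrated \<alpha> C \<mu> (Suc k) y} y \<partial>reward_table \<mu>)"
    unfolding burn_in_def by (intro nn_integral_suminf) measurable
  also have "\<dots> = (\<Sum>k. emeasure (reward_table \<mu>) {y\<in>space (reward_table \<mu>). \<not> concentrated \<alpha> C \<mu> (Suc k) y})"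
    by (intro suminf_cong) (simp flip: nn_integral_indicator add: indicator_def cong: nn_integral_cong)
  also have "\<dots> \<le> (\<Sum>k. ennreal (8 / C * S * real (Suc k) powr - q))"
    unfolding S_def q_def by (intro suminf_le emeasure_not_concentrated_le \<mu> C) auto
  also have "\<dots> = ennreal (\<Sum>k. 8 / C * S * real (Suc k) powr - q)"
    using C \<open>0 \<le> S\<close> by (intro suminf_ennreal2 summable_mult summable) auto
  finally show ?thesis
    by (auto intro: le_less_trans)
qed

text \<open>Every failure before the first success adds 1 to the series, so a finite value forces a
  success and bounds its index.\<close>

lemma concentrated_before_burn_in:
  assumes "burn_in \<alpha> C \<mu> y < \<infinity>"
  obtains w where "concentrated \<alpha> C \<mu> (Suc w) y" "ennreal (real w) \<le> burn_in \<alpha> C \<mu> y"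
proof -
  let ?f = "\<lambda>k. indicator {y. \<not> concentrated \<alpha> C \<mu> (Suc k) y} y :: ennreal"
  have le: "ennreal (real n) \<le> burn_in \<alpha> C \<mu> y" if "\<And>k. k < n \<Longrightarrow> \<not> concentrated \<alpha> C \<mu> (Suc k) y" for n
  proof -
    have "ennreal (real n) = (\<Sum>k<n. ?f k)"
      using that by (simp add: indicator_def ennreal_of_nat_eq_real_of_nat)
    also have "\<dots> \<le> burn_in \<alpha> C \<mu> y"
      unfolding burn_in_def by (intro sum_le_suminf) auto
    finally show ?thesis .
  qed
  have "\<exists>k. concentrated \<alpha> C \<mu> (Suc k) y"
  proof (rule ccontr)
    assume "\<not> (\<exists>k. concentrated \<alpha> C \<mu> (Suc k) y)"
    then have "of_nat n \<le> burn_in \<alpha> C \<mu> y" for n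
      using le[of n] by (simp add: ennreal_of_nat_eq_real_of_nat)
    with assms show False
      using ennreal_Ex_less_of_nat[of "burn_in \<alpha> C \<mu> y"] by (auto simp: not_less[symmetric])
  qed
  then have "concentrated \<alpha> C \<mu> (Suc (LEAST k. concentrated \<alpha> C \<mu> (Suc k) y)) y"
    by (rule LeastI_ex)
  moreover have "ennreal (real (LEAST k. concentrated \<alpha> C \<mu> (Suc k) y)) \<le> burn_in \<alpha> C \<mu> y"
    by (intro le not_less_Least)
  ultimately show thesis
    by (rule that)
qed

subsection \<open>Expected stopping time\<close>

text \<open>The event is uniform in the number of draws, so it may be evaluated at the random count
  \<open>?N\<close>, which is at most \<open>t\<close>.\<close>

lemma concentrated_bounds:
  assumes "concentrated \<alpha> C \<mu> k (snd \<omega>)" "p \<in> arms" "k \<le> t"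
    and "1 \<le> C" "0 \<le> \<alpha>" "0 < \<delta>" "\<delta> \<le> 1"
  shows "lower_bound (exploration_rate \<alpha> C \<delta>) v (run A \<omega> t) p \<le> \<mu> p"
    and "\<mu> p \<le> upper_bound (exploration_rate \<alpha> C \<delta>) v (run A \<omega> t) p"
proof -
  let ?N = "num_draws (run A \<omega> t) p"
  have "\<bar>table_mean (snd \<omega>) p ?N - \<mu> p\<bar> \<le> sqrt (exploration_rate \<alpha> C \<delta> t / (2 * real ?N))" if "0 < ?N"
    using num_draws_le_length[of "run A \<omega> t" p] that assms by (intro concentratedD[OF assms(1,2)]) simp_all
  then show "lower_bound (exploration_rate \<alpha> C \<delta>) v (run A \<omega> t) p \<le> \<mu> p"
    and "\<mu> p \<le> upper_bound (exploration_rate \<alpha> C \<delta>) v (run A \<omega> t) p"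
    by (auto intro!: lower_bound_run_le upper_bound_run_ge)
qed

text \<open>Absorbs the logarithmic growth of the rate into a small multiple of the round. The
  constant comes from \<open>ln y \<le> y\<close> at \<open>y = \<eta> / c * x\<close>.\<close>

lemma ln_le_linear:
  fixes c \<eta> :: real
  assumes "0 \<le> c" "0 < \<eta>"
  shows "\<exists>K\<ge>0. \<forall>x>0. c * ln x \<le> \<eta> * x + K"
proof (cases "c = 0")
  case True
  then show ?thesis
    using assms by (intro exI[of _ 0]) auto
next
  case False
  then have c: "0 < c"
    using assms by simp
  show ?thesis
  proof (intro exI[of _ "\<bar>c * ln (c / \<eta>)\<bar>"] conjI allI impI)
    fix x :: real assume x: "0 < x"
    have "ln (\<eta> / c * x) \<le> \<eta> / c * x"
      using c assms x by (intro order.trans[OF ln_le_minus_one]) auto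
    then have "c * ln (\<eta> / c * x) \<le> c * (\<eta> / c * x)"
      using c by (intro mult_left_mono) auto
    moreover have "ln (\<eta> / c * x) = ln x - ln (c / \<eta>)"
      using c assms x by (simp add: ln_mult ln_div)
    ultimately show "c * ln x \<le> \<eta> * x + \<bar>c * ln (c / \<eta>)\<bar>"
      using c by (simp add: right_diff_distrib)
  qed simp
qed

lemma fst_in_space_seed: "\<omega> \<in> space (bandit_measure R \<mu>) \<Longrightarrow> fst \<omega> \<in> space R"
  by (auto simp: bandit_measure_eq space_pair_measure)

definition complexity :: "(arm \<Rightarrow> real) \<Rightarrow> real" where
  "complexity \<mu> = (\<Sum>p\<in>arms. 8 / gap_sq \<mu> p)"

context
  fixes \<mu> :: "arm \<Rightarrow> real" and C \<alpha> :: real and R :: "'r measure"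
  assumes \<mu>: "bandit_instance \<mu>" "\<mu> (2,1) < \<mu> (1,1)"
    and C: "1 \<le> C" "1 < \<alpha>"
    and R: "prob_space R"
begin

lemma complexity_pos: "0 < complexity \<mu>"
  unfolding complexity_def using gap_sq_pos[OF \<mu>] finite_arms card_arms by (intro sum_pos) auto

lemma mean_bounds: "p \<in> arms \<Longrightarrow> 0 \<le> \<mu> p \<and> \<mu> p \<le> 1"
  using \<mu> by (simp add: bandit_instance_def)

text \<open>Solves the inequality of \<open>run_length_le\<close> for \<open>t\<close> after its
  logarithm has been absorbed. \<open>K\<close> is a parameter so that it can be fixed before
  \<open>\<delta>\<close>, which then enters only through \<open>ln (1 / \<delta>)\<close>.\<close>

lemma stopping_time_le_burn_in:
  assumes A: "mlucb_variant (exploration_rate \<alpha> C \<delta>) R A" "fst \<omega> \<in> space R"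
    and \<delta>: "0 < \<delta>" "\<delta> < 1"
    and K: "0 \<le> K" "\<And>x. 0 < x \<Longrightarrow> complexity \<mu> * (1 + \<alpha>) * ln x \<le> \<eta> * x + K"
    and \<eta>: "\<eta> < 1"
    and fin: "burn_in \<alpha> C \<mu> (snd \<omega>) < \<infinity>"
  obtains s where "stopping_time (exploration_rate \<alpha> C \<delta>) A \<omega> = enat s"
    and "ennreal (real s) \<le> ennreal ((5 + complexity \<mu> * ln C + K + complexity \<mu> * ln (1 / \<delta>)) / (1 - \<eta>))
           + ennreal (1 / (1 - \<eta>)) * burn_in \<alpha> C \<mu> (snd \<omega>)"
proof -
  obtain w where w: "concentrated \<alpha> C \<mu> (Suc w) (snd \<omega>)" "ennreal (real w) \<le> burn_in \<alpha> C \<mu> (snd \<omega>)"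
    using concentrated_before_burn_in[OF fin] .
  \<comment> \<open>The 5 is the 4 of \<open>run_length_le\<close> plus 1, since the intervals are
    known to be valid from round \<open>Suc w\<close>.\<close>
  define a where "a = 5 + complexity \<mu> * ln C + K + complexity \<mu> * ln (1 / \<delta>)"
  have a: "0 \<le> a"
    using complexity_pos C \<delta> K(1) by (auto simp: a_def intro!: add_nonneg_nonneg mult_nonneg_nonneg)
  have "real t \<le> (a + w) / (1 - \<eta>)"
    if go: "\<And>s. s < t \<Longrightarrow> \<not> stop_cond (exploration_rate \<alpha> C \<delta>) (mean0 A) (run A \<omega> s)" for t
  proof (cases "t = 0")
    case False
    have "real t \<le> real (Suc w) + 4 + complexity \<mu> * exploration_rate \<alpha> C \<delta> t"
      using C \<delta>
      unfolding complexity_def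
      by (intro run_length_le[OF A \<mu> _ _ go] mono_exploration_rate concentrated_bounds[OF w(1)]) auto
    also have "complexity \<mu> * exploration_rate \<alpha> C \<delta> t =
        complexity \<mu> * ln (1 / \<delta>) + complexity \<mu> * ln C + complexity \<mu> * (1 + \<alpha>) * ln (real t)"
      using C \<delta> False by (simp add: exploration_rate_eq distrib_left mult.assoc)
    also have "complexity \<mu> * (1 + \<alpha>) * ln (real t) \<le> \<eta> * t + K"
      using False by (intro K(2)) simp
    finally have "real t * (1 - \<eta>) \<le> a + w"
      by (simp add: a_def algebra_simps)
    then show ?thesis
      using \<eta> by (simp add: pos_le_divide_eq)
  qed (use a \<eta> in simp)
  then obtain s where s: "stopping_time (exploration_rate \<alpha> C \<delta>) A \<omega> = enat s" "real s \<le> (a + w) / (1 - \<eta>)"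
    by (rule stopping_time_le)
  from s(2) have "ennreal (real s) \<le> ennreal (a / (1 - \<eta>) + 1 / (1 - \<eta>) * w)"
    by (intro ennreal_leI) (simp add: add_divide_distrib)
  also have "\<dots> = ennreal (a / (1 - \<eta>)) + ennreal (1 / (1 - \<eta>)) * ennreal (real w)"
    using a \<eta> by (simp flip: ennreal_plus ennreal_mult)
  also have "\<dots> \<le> ennreal (a / (1 - \<eta>)) + ennreal (1 / (1 - \<eta>)) * burn_in \<alpha> C \<mu> (snd \<omega>)"
    by (intro add_left_mono mult_left_mono w(2)) simp
  finally show thesis
    using s(1) by (intro that[of s]) (auto simp: a_def)
qed

lemma nn_integral_bandit_burn_in:
  "(\<integral>\<^sup>+ \<omega>. burn_in \<alpha> C \<mu> (snd \<omega>) \<partial>bandit_measure R \<mu>) < \<infinity>"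
proof -
  have "(\<integral>\<^sup>+ \<omega>. burn_in \<alpha> C \<mu> (snd \<omega>) \<partial>bandit_measure R \<mu>) =
      (\<integral>\<^sup>+ y. burn_in \<alpha> C \<mu> y \<partial>distr (bandit_measure R \<mu>) (reward_table \<mu>) snd)"
    by (intro nn_integral_distr[symmetric]) measurable
  then show ?thesis
    using nn_integral_burn_in_finite[OF mean_bounds C] by (simp add: distr_snd_bandit_measure[OF R])
qed

text \<open>Integrates the pathwise bound. \<open>K\<close> precedes \<open>\<delta>\<close> and
  \<open>A\<close>, so the algorithm may change with \<open>\<delta>\<close> in the limit.\<close>

lemma expected_stopping_time_le:
  assumes \<eta>: "0 < \<eta>" "\<eta> < 1"
  shows "\<exists>K\<ge>0. \<forall>\<delta> A. 0 < \<delta> \<longrightarrow> \<delta> < 1 \<longrightarrow> mlucb_variant (exploration_rate \<alpha> C \<delta>) R A \<longrightarrow>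
           expected_stopping_time R \<mu> (exploration_rate \<alpha> C \<delta>) A
             \<le> ennreal ((K + complexity \<mu> * ln (1 / \<delta>)) / (1 - \<eta>))"
proof -
  interpret prob_space "bandit_measure R \<mu>"
    by (rule prob_space_bandit_measure[OF R])
  have "0 \<le> complexity \<mu> * (1 + \<alpha>)"
    using complexity_pos C by simp
  from ln_le_linear[OF this \<eta>(1)] obtain K
    where K: "0 \<le> K" "\<And>x. 0 < x \<Longrightarrow> complexity \<mu> * (1 + \<alpha>) * ln x \<le> \<eta> * x + K"
    by auto
  obtain B where B: "0 \<le> B" "(\<integral>\<^sup>+ \<omega>. burn_in \<alpha> C \<mu> (snd \<omega>) \<partial>bandit_measure R \<mu>) = ennreal B"
    using nn_integral_bandit_burn_in by (cases "\<integral>\<^sup>+ \<omega>. burn_in \<alpha> C \<mu> (snd \<omega>) \<partial>bandit_measure R \<mu>") auto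
  define K' where "K' = 5 + complexity \<mu> * ln C + K + B"
  show ?thesis
  proof (intro exI[of _ K'] conjI allI impI)
    show "0 \<le> K'"
      using complexity_pos C K(1) B(1) by (auto simp: K'_def intro!: add_nonneg_nonneg mult_nonneg_nonneg)
    fix \<delta> and A :: "'r algorithm"
    assume \<delta>: "0 < \<delta>" "\<delta> < 1" and A: "mlucb_variant (exploration_rate \<alpha> C \<delta>) R A"
    define a where "a = 5 + complexity \<mu> * ln C + K + complexity \<mu> * ln (1 / \<delta>)"
    have a: "0 \<le> a"
      using complexity_pos C \<delta> K(1) by (auto simp: a_def intro!: add_nonneg_nonneg mult_nonneg_nonneg)
    have "ennreal_of_enat (stopping_time (exploration_rate \<alpha> C \<delta>) A \<omega>)
        \<le> ennreal (a / (1 - \<eta>)) + ennreal (1 / (1 - \<eta>)) * burn_in \<alpha> C \<mu> (snd \<omega>)"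
      if \<omega>: "\<omega> \<in> space (bandit_measure R \<mu>)" for \<omega>
    proof (cases "burn_in \<alpha> C \<mu> (snd \<omega>) < \<infinity>")
      case True
      obtain s where s: "stopping_time (exploration_rate \<alpha> C \<delta>) A \<omega> = enat s"
        "ennreal (real s) \<le> ennreal (a / (1 - \<eta>)) + ennreal (1 / (1 - \<eta>)) * burn_in \<alpha> C \<mu> (snd \<omega>)"
        using stopping_time_le_burn_in[OF A fst_in_space_seed[OF \<omega>] \<delta> K \<eta>(2) True] unfolding a_def .
      then show ?thesis
        by (simp add: ennreal_of_nat_eq_real_of_nat)
    next
      \<comment> \<open>Where the burn-in is infinite the bound is infinite as well, so it holds at
        every outcome.\<close>
      case False
      then have "burn_in \<alpha> C \<mu> (snd \<omega>) = \<infinity>"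
        by (metis infinity_ennreal_def top.not_eq_extremum)
      then show ?thesis
        using \<eta> by (simp add: ennreal_mult_top)
    qed
    then have "expected_stopping_time R \<mu> (exploration_rate \<alpha> C \<delta>) A
        \<le> (\<integral>\<^sup>+ \<omega>. ennreal (a / (1 - \<eta>)) + ennreal (1 / (1 - \<eta>)) * burn_in \<alpha> C \<mu> (snd \<omega>) \<partial>bandit_measure R \<mu>)"
      unfolding expected_stopping_time_def by (rule nn_integral_mono)
    also have "\<dots> = ennreal (a / (1 - \<eta>)) + ennreal (1 / (1 - \<eta>)) * ennreal B"
      by (simp add: nn_integral_add nn_integral_cmult emeasure_space_1 B(2))
    also have "\<dots> = ennreal (a / (1 - \<eta>) + 1 / (1 - \<eta>) * B)"
      using a \<eta> B(1) by (simp flip: ennreal_plus ennreal_mult)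
    also have "a / (1 - \<eta>) + 1 / (1 - \<eta>) * B = (K' + complexity \<mu> * ln (1 / \<delta>)) / (1 - \<eta>)"
      by (simp add: a_def K'_def add_divide_distrib)
    finally show "expected_stopping_time R \<mu> (exploration_rate \<alpha> C \<delta>) A
        \<le> ennreal ((K' + complexity \<mu> * ln (1 / \<delta>)) / (1 - \<eta>))" .
  qed
qed

text \<open>An integrable burn-in is finite almost surely; any \<open>\<eta>\<close> strictly
  between 0 and 1 would do, and \<open>1 / 2\<close> is taken.\<close>

lemma AE_stops:
  assumes A: "mlucb_variant (exploration_rate \<alpha> C \<delta>) R A" and \<delta>: "0 < \<delta>" "\<delta> < 1"
  shows "AE \<omega> in bandit_measure R \<mu>. \<exists>s. stopping_time (exploration_rate \<alpha> C \<delta>) A \<omega> = enat s"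
proof -
  have "0 \<le> complexity \<mu> * (1 + \<alpha>)"
    using complexity_pos C by simp
  from ln_le_linear[OF this, of "1 / 2"] obtain K
    where K: "0 \<le> K" "\<And>x. 0 < x \<Longrightarrow> complexity \<mu> * (1 + \<alpha>) * ln x \<le> 1 / 2 * x + K"
    by auto
  have "AE \<omega> in bandit_measure R \<mu>. burn_in \<alpha> C \<mu> (snd \<omega>) \<noteq> \<infinity>"
    using nn_integral_bandit_burn_in by (intro nn_integral_PInf_AE) auto
  then show ?thesis
  proof (rule AE_mp, intro AE_I2 impI)
    fix \<omega> assume \<omega>: "\<omega> \<in> space (bandit_measure R \<mu>)" and "burn_in \<alpha> C \<mu> (snd \<omega>) \<noteq> \<infinity>"
    then have "burn_in \<alpha> C \<mu> (snd \<omega>) < \<infinity>"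
      by (simp add: less_top)
    from stopping_time_le_burn_in[OF A fst_in_space_seed[OF \<omega>] \<delta> K _ this]
    show "\<exists>s. stopping_time (exploration_rate \<alpha> C \<delta>) A \<omega> = enat s"
      by fastforce
  qed
qed

text \<open>Two limits in succession: for fixed \<open>\<eta>\<close> the constant \<open>K\<close>
  disappears after division by \<open>ln (1 / \<delta>)\<close>, and then \<open>\<eta>\<close>
  tends to 0.\<close>

lemma Limsup_expected_stopping_time_le:
  assumes A: "\<And>\<delta>. 0 < \<delta> \<Longrightarrow> \<delta> < 1 \<Longrightarrow> mlucb_variant (exploration_rate \<alpha> C \<delta>) R (A \<delta>)"
  shows "Limsup (at_right 0) (\<lambda>\<delta>. expected_stopping_time R \<mu> (exploration_rate \<alpha> C \<delta>) (A \<delta>) / ennreal (ln (1 / \<delta>)))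
           \<le> ennreal (complexity \<mu>)"
    (is "?L \<le> _")
proof -
  have le: "?L \<le> ennreal (complexity \<mu> / (1 - \<eta>))" if \<eta>: "0 < \<eta>" "\<eta> < 1" for \<eta>
  proof -
    obtain K where K: "0 \<le> K"
      "\<forall>\<delta> A. 0 < \<delta> \<longrightarrow> \<delta> < 1 \<longrightarrow> mlucb_variant (exploration_rate \<alpha> C \<delta>) R A \<longrightarrow>
         expected_stopping_time R \<mu> (exploration_rate \<alpha> C \<delta>) A
           \<le> ennreal ((K + complexity \<mu> * ln (1 / \<delta>)) / (1 - \<eta>))"
      using expected_stopping_time_le[OF \<eta>] by blast
    define g where "g = (\<lambda>\<delta>. (K / ln (1 / \<delta>) + complexity \<mu>) / (1 - \<eta>))"
    have "eventually (\<lambda>\<delta>. \<delta> \<in> {0<..<1}) (at_right (0 :: real))"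
      by (intro eventually_at_right_real) simp
    then have "eventually (\<lambda>\<delta>. expected_stopping_time R \<mu> (exploration_rate \<alpha> C \<delta>) (A \<delta>) / ennreal (ln (1 / \<delta>))
        \<le> ennreal (g \<delta>)) (at_right 0)"
    proof eventually_elim
      case (elim \<delta>)
      then have pos: "0 < ln (1 / \<delta>)"
        by simp
      have "expected_stopping_time R \<mu> (exploration_rate \<alpha> C \<delta>) (A \<delta>) / ennreal (ln (1 / \<delta>))
          \<le> ennreal ((K + complexity \<mu> * ln (1 / \<delta>)) / (1 - \<eta>)) / ennreal (ln (1 / \<delta>))"
        using elim by (intro divide_right_mono_ennreal K(2)[rule_format] A) auto
      also have "\<dots> = ennreal ((K + complexity \<mu> * ln (1 / \<delta>)) / (1 - \<eta>) / ln (1 / \<delta>))"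
        using pos \<eta> K(1) complexity_pos
        by (intro divide_ennreal divide_nonneg_pos add_nonneg_nonneg mult_nonneg_nonneg) auto
      also have "(K + complexity \<mu> * ln (1 / \<delta>)) / (1 - \<eta>) / ln (1 / \<delta>) = g \<delta>"
        using pos \<eta> by (simp add: g_def field_simps)
      finally show ?case .
    qed
    then have "?L \<le> Limsup (at_right 0) (\<lambda>\<delta>. ennreal (g \<delta>))"
      by (rule Limsup_mono)
    also have "\<dots> = ennreal (complexity \<mu> / (1 - \<eta>))"
    proof (intro lim_imp_Limsup tendsto_ennrealI)
      have "((\<lambda>\<delta>. K / ln (1 / \<delta>)) \<longlongrightarrow> 0) (at_right 0)"
        by real_asymp
      then have "(g \<longlongrightarrow> (0 + complexity \<mu>) / (1 - \<eta>)) (at_right 0)"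
        unfolding g_def using \<eta> by (intro tendsto_intros) auto
      then show "(g \<longlongrightarrow> complexity \<mu> / (1 - \<eta>)) (at_right 0)"
        by simp
    qed simp
    finally show ?thesis .
  qed
  have "((\<lambda>\<eta>. complexity \<mu> / (1 - \<eta>)) \<longlongrightarrow> complexity \<mu> / (1 - 0)) (at_right 0)"
    by (intro tendsto_intros) auto
  then have "((\<lambda>\<eta>. ennreal (complexity \<mu> / (1 - \<eta>))) \<longlongrightarrow> ennreal (complexity \<mu>)) (at_right 0)"
    using tendsto_ennrealI by fastforce
  moreover have "eventually (\<lambda>\<eta>. ?L \<le> ennreal (complexity \<mu> / (1 - \<eta>))) (at_right 0)"
    using eventually_at_right_real[of 0 1] by (auto elim!: eventually_mono intro!: le)
  ultimately show ?thesis
    by (intro tendsto_lowerbound) auto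
qed

end

subsection \<open>Correctness of the recommendation\<close>

text \<open>In round 1 the rate is \<open>ln (C / \<delta>)\<close>, which would be negative for
  \<open>\<delta>\<close> between \<open>C\<close> and 1.\<close>

lemma rate_bound_imp_ge_1:
  assumes "0 < C" "\<And>\<delta>. 0 < \<delta> \<Longrightarrow> \<delta> < 1 \<Longrightarrow> 0 \<le> exploration_rate \<alpha> C \<delta> 1"
  shows "1 \<le> C"
proof (rule ccontr)
  assume "\<not> 1 \<le> C"
  then obtain \<delta> where \<delta>: "C < \<delta>" "\<delta> < 1"
    using dense[of C 1] by auto
  then have "C / \<delta> < 1"
    using assms(1) by simp
  then show False
    using assms(2)[of \<delta>] assms(1) \<delta> by (simp add: exploration_rate_def)
qed

text \<open>For \<open>t \<ge> 2\<close> the two logarithms are at least \<open>1 / 2\<close> and 1,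
  so each term of the given series is at least half of \<open>t powr - (1 + \<alpha>)\<close>. The
  factor \<open>4 * exp 1\<close> then leaves room for 3 times the tail.\<close>

lemma C_bound_imp_tail_bound:
  assumes \<alpha>: "1 < \<alpha>" and C: "1 \<le> C"
    and bound: "exp 1 * real (card arms) *
           (\<Sum>n. ln (real (Suc n)) * ln (C * real (Suc n) powr (1 + \<alpha>)) / real (Suc n) powr (1 + \<alpha>)) \<le> C"
  shows "summable (\<lambda>n. real (Suc (Suc n)) powr - (1 + \<alpha>))"
    and "3 * (\<Sum>n. real (Suc (Suc n)) powr - (1 + \<alpha>)) \<le> C"
proof -
  define f where "f = (\<lambda>n. ln (real (Suc n)) * ln (C * real (Suc n) powr (1 + \<alpha>)) / real (Suc n) powr (1 + \<alpha>))"
  define g where "g = (\<lambda>n. real (Suc (Suc n)) powr - (1 + \<alpha>))"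
  have "summable (\<lambda>n. real n powr - (1 + \<alpha>))"
    using \<alpha> by (subst summable_real_powr_iff) auto
  then have g: "summable g"
    unfolding g_def by (subst summable_Suc_iff)+
  then show "summable (\<lambda>n. real (Suc (Suc n)) powr - (1 + \<alpha>))"
    unfolding g_def .
  \<comment> \<open>A bound on \<open>suminf\<close> is informative only for a summable series. One
    power of \<open>n\<close> absorbs both logarithms, leaving the exponent
    \<open>\<alpha> > 1\<close>.\<close>
  have f: "summable f"
  proof (rule summable_comparison_test_bigo)
    show "summable (\<lambda>n. norm (real n powr - \<alpha>))"
      using \<alpha> by (simp add: summable_real_powr_iff)
    show "f \<in> O(\<lambda>n. real n powr - \<alpha>)"
      unfolding f_def using \<alpha> C by real_asymp
  qed
  have ln2: "1 / 2 \<le> ln (2 :: real)"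
    using ln2_ge_two_thirds by simp
  have f_ge: "1 / 2 * g n \<le> f (Suc n)" for n
  proof -
    have "ln 2 \<le> ln (real (Suc (Suc n)))"
      by simp
    then have l: "1 / 2 \<le> ln (real (Suc (Suc n)))"
      using ln2 by linarith
    have "2 * ln (real (Suc (Suc n))) \<le> (1 + \<alpha>) * ln (real (Suc (Suc n)))"
      using \<alpha> by (intro mult_right_mono) auto
    also have "\<dots> \<le> ln (C * real (Suc (Suc n)) powr (1 + \<alpha>))"
      using C by (simp add: ln_mult ln_powr)
    finally have "1 \<le> ln (C * real (Suc (Suc n)) powr (1 + \<alpha>))"
      using l by linarith
    with l have "1 / 2 * 1 \<le> ln (real (Suc (Suc n))) * ln (C * real (Suc (Suc n)) powr (1 + \<alpha>))"
      by (intro mult_mono) auto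
    then have "1 / 2 * 1 / real (Suc (Suc n)) powr (1 + \<alpha>) \<le> f (Suc n)"
      unfolding f_def by (intro divide_right_mono) auto
    then show ?thesis
      unfolding g_def powr_minus_divide times_divide_eq_right .
  qed
  have "1 / 2 * suminf g = (\<Sum>n. 1 / 2 * g n)"
    by (rule suminf_mult[OF g, symmetric])
  also have "\<dots> \<le> (\<Sum>n. f (Suc n))"
    by (intro suminf_le f_ge summable_mult g) (use f in \<open>simp only: summable_Suc_iff\<close>)
  \<comment> \<open>The term at index 0 vanishes because \<open>ln 1 = 0\<close>.\<close>
  also have "\<dots> = suminf f"
    using suminf_split_head[OF f] by (simp add: f_def)
  finally have "suminf g \<le> 2 * suminf f" by simp
  moreover have "0 \<le> suminf g"
    using g by (intro suminf_nonneg) (auto simp: g_def)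
  ultimately have "3 * suminf g \<le> 2 * 4 * suminf f"
    by simp
  also have "\<dots> \<le> exp 1 * 4 * suminf f"
    using exp_ge_add_one_self[of 1] \<open>0 \<le> suminf g\<close> \<open>suminf g \<le> 2 * suminf f\<close>
    by (intro mult_right_mono) auto
  also have "\<dots> \<le> C"
    using bound by (simp add: f_def card_arms)
  finally show "3 * (\<Sum>n. real (Suc (Suc n)) powr - (1 + \<alpha>)) \<le> C"
    unfolding g_def .
qed

text \<open>When the run stops in round \<open>t\<close>, every arm has fewer than \<open>t\<close> draws, so a wrong recommendation
  forces a deviation after some number \<open>n\<close> of draws at the level of round \<open>n + 1\<close>. The union bound is
  thus over \<open>n\<close> rather than \<open>t\<close>, which avoids the factor \<open>ln (1 / \<delta>)\<close> of a peeling argument.\<close>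

lemma delta_PAC_mlucb_variant:
  assumes C: "1 \<le> C" and \<alpha>: "1 < \<alpha>" and R: "prob_space R" and \<delta>: "0 < \<delta>" "\<delta> < 1"
    and summable: "summable (\<lambda>n. real (Suc (Suc n)) powr - (1 + \<alpha>))"
    and sum_le: "3 * (\<Sum>n. real (Suc (Suc n)) powr - (1 + \<alpha>)) \<le> C"
    and A: "mlucb_variant (exploration_rate \<alpha> C \<delta>) R A"
  shows "delta_PAC R \<delta> (exploration_rate \<alpha> C \<delta>) A"
  unfolding delta_PAC_def
proof (intro allI impI, elim conjE)
  fix \<mu> assume \<mu>: "bandit_instance \<mu>" "\<mu> (2,1) < \<mu> (1,1)"
  interpret prob_space "bandit_measure R \<mu>"
    by (rule prob_space_bandit_measure[OF R])
  interpret T: prob_space "reward_table \<mu>"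
    by (rule prob_space_reward_table)
  let ?\<beta> = "exploration_rate \<alpha> C \<delta>"
  define r where "r = (\<lambda>n. sqrt (?\<beta> (Suc (Suc n)) / (2 * real (Suc n))))"
  define Lo where "Lo = (\<lambda>p n. {y\<in>space (reward_table \<mu>). table_mean y p (Suc n) \<le> \<mu> p - r n})"
  define Up where "Up = (\<lambda>p n. {y\<in>space (reward_table \<mu>). table_mean y p (Suc n) \<ge> \<mu> p + r n})"
  define D where "D = (\<lambda>n. Lo (1,1) n \<union> Lo (1,2) n \<union> Up (2,1) n)"
  have [measurable]: "Lo p n \<in> T.events" "Up p n \<in> T.events" for p n
    unfolding Up_def Lo_def by measurable
  have [measurable]: "D n \<in> T.events" for n
    unfolding D_def by measurable
  have D_le: "T.prob (D n) \<le> 3 * \<delta> / C * real (Suc (Suc n)) powr - (1 + \<alpha>)" for n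
  proof -
    have arms: "(1,1) \<in> arms" "(1,2) \<in> arms" "(2,1) \<in> arms"
      by (auto simp: arms_def)
    have "0 \<le> ?\<beta> (Suc (Suc n))"
      using C \<alpha> \<delta> by (intro exploration_rate_nonneg) auto
    then have "T.prob (Lo p n) \<le> exp (- ?\<beta> (Suc (Suc n)))" "T.prob (Up p n) \<le> exp (- ?\<beta> (Suc (Suc n)))"
      if "p \<in> arms" for p
      unfolding Lo_def Up_def r_def using \<mu> that
      by (auto intro!: Hoeffding_table_mean simp: bandit_instance_def simp del: of_nat_Suc)
    note this(1)[OF arms(1)] this(1)[OF arms(2)] this(2)[OF arms(3)]
    moreover have "T.prob (D n) \<le> T.prob (Lo (1,1) n) + T.prob (Lo (1,2) n) + T.prob (Up (2,1) n)"
      unfolding D_def by (intro order.trans[OF measure_Un_le] add_mono measure_Un_le order.refl) measurable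
    moreover have "exp (- ?\<beta> (Suc (Suc n))) = \<delta> / C * real (Suc (Suc n)) powr - (1 + \<alpha>)"
      using C \<delta> by (intro exp_minus_exploration_rate) auto
    ultimately show ?thesis
      by simp
  qed
  have summable': "summable (\<lambda>n. 3 * \<delta> / C * real (Suc (Suc n)) powr - (1 + \<alpha>))"
    by (intro summable_mult summable)
  have summable_D: "summable (\<lambda>n. T.prob (D n))"
    by (rule summable_comparison_test'[OF summable', of 0])
       (simp only: real_norm_def abs_of_nonneg measure_nonneg D_le)
  have "T.prob (\<Union>n. D n) \<le> (\<Sum>n. T.prob (D n))"
    by (intro T.finite_measure_subadditive_countably summable_D) auto
  also have "\<dots> \<le> (\<Sum>n. 3 * \<delta> / C * real (Suc (Suc n)) powr - (1 + \<alpha>))"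
    by (intro suminf_le D_le summable_D summable')
  also have "\<dots> = \<delta> / C * (3 * (\<Sum>n. real (Suc (Suc n)) powr - (1 + \<alpha>)))"
    by (subst suminf_mult[OF summable]) simp
  also have "\<dots> \<le> \<delta> / C * C"
    using sum_le C \<delta> by (intro mult_left_mono) auto
  finally have D: "T.prob (\<Union>n. D n) \<le> \<delta>"
    using C by simp
  have correct: "\<omega> \<in> correct_event R \<mu> ?\<beta> A"
    if \<omega>: "\<omega> \<in> space (bandit_measure R \<mu>)" and stops: "stopping_time ?\<beta> A \<omega> = enat t" and "snd \<omega> \<notin> (\<Union>n. D n)" for \<omega> t
  proof -
    have y: "snd \<omega> \<in> space (reward_table \<mu>)"
      using \<omega> by (auto simp: bandit_measure_eq space_pair_measure)
    have stop: "stop_cond ?\<beta> (mean0 A) (run A \<omega> t)"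
      using stops by (simp add: stopping_time_eq_enat_iff)
    have r_le: "r n \<le> sqrt (?\<beta> t / (2 * real (num_draws (run A \<omega> t) p)))" if "num_draws (run A \<omega> t) p = Suc n" for n p
    proof -
      have "Suc (Suc n) \<le> t"
        using num_draws_less_length_if_stop[OF stop, of p] that by simp
      then have "?\<beta> (Suc (Suc n)) \<le> ?\<beta> t"
        using C \<alpha> \<delta> by (intro monoD[OF mono_exploration_rate]) auto
      then show ?thesis
        unfolding r_def that by (intro real_sqrt_le_mono divide_right_mono) simp_all
    qed
    have "\<mu> (1, j) \<le> upper_bound ?\<beta> (mean0 A) (run A \<omega> t) (1, j)" if j: "j \<in> {1, 2}" for j
    proof (rule upper_bound_run_ge)
      assume "0 < num_draws (run A \<omega> t) (1, j)"
      then obtain n where n: "num_draws (run A \<omega> t) (1, j) = Suc n"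
        using gr0_implies_Suc by blast
      have "snd \<omega> \<notin> Lo (1, j) n"
        using j \<open>snd \<omega> \<notin> (\<Union>n. D n)\<close> by (auto simp: D_def)
      then have "\<mu> (1, j) - r n < table_mean (snd \<omega>) (1, j) (Suc n)"
        using y by (simp add: Lo_def)
      then show "\<mu> (1, j) - sqrt (?\<beta> t / (2 * real (num_draws (run A \<omega> t) (1, j))))
          \<le> table_mean (snd \<omega>) (1, j) (num_draws (run A \<omega> t) (1, j))"
        using r_le[OF n] unfolding n by linarith
    qed
    moreover have "lower_bound ?\<beta> (mean0 A) (run A \<omega> t) (2, 1) \<le> \<mu> (2, 1)"
    proof (rule lower_bound_run_le)
      assume "0 < num_draws (run A \<omega> t) (2, 1)"
      then obtain n where n: "num_draws (run A \<omega> t) (2, 1) = Suc n"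
        using gr0_implies_Suc by blast
      have "snd \<omega> \<notin> Up (2, 1) n"
        using \<open>snd \<omega> \<notin> (\<Union>n. D n)\<close> by (auto simp: D_def)
      then have "table_mean (snd \<omega>) (2, 1) (Suc n) < \<mu> (2, 1) + r n"
        using y by (simp add: Up_def)
      then show "table_mean (snd \<omega>) (2, 1) (num_draws (run A \<omega> t) (2, 1))
          \<le> \<mu> (2, 1) + sqrt (?\<beta> t / (2 * real (num_draws (run A \<omega> t) (2, 1))))"
        using r_le[OF n] unfolding n by linarith
    qed
    moreover have "0 \<le> ?\<beta> (length (run A \<omega> t))"
      using C \<alpha> \<delta> by (intro exploration_rate_nonneg) auto
    ultimately have "best_action A (fst \<omega>) (run A \<omega> t) = 1"
      by (intro best_action_eq_1[OF A fst_in_space_seed[OF \<omega>] \<mu> _ stop])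
    then show ?thesis
      using \<omega> stops by (auto simp: correct_event_def)
  qed
  let ?F = "space (bandit_measure R \<mu>) - correct_event R \<mu> ?\<beta> A"
  have F: "correct_event R \<mu> ?\<beta> A \<in> events"
    by (rule correct_event_measurable[OF A])
  \<comment> \<open>Runs that never stop also count as failures, but they form a null set, so the
    inclusion in the deviation event is needed only almost everywhere.\<close>
  have "prob ?F \<le> prob (snd -` (\<Union>n. D n) \<inter> space (bandit_measure R \<mu>))"
  proof (rule finite_measure_mono_AE)
    show "AE \<omega> in bandit_measure R \<mu>. \<omega> \<in> ?F \<longrightarrow> \<omega> \<in> snd -` (\<Union>n. D n) \<inter> space (bandit_measure R \<mu>)"
      using AE_stops[OF \<mu> C \<alpha> R A \<delta>]
    proof (rule AE_mp, intro AE_I2 impI)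
      fix \<omega> assume "\<exists>t. stopping_time ?\<beta> A \<omega> = enat t" "\<omega> \<in> ?F"
      then show "\<omega> \<in> snd -` (\<Union>n. D n) \<inter> space (bandit_measure R \<mu>)"
        using correct by blast
    qed
    show "snd -` (\<Union>n. D n) \<inter> space (bandit_measure R \<mu>) \<in> events"
      by (intro measurable_sets[OF snd_measurable_bandit]) measurable
  qed
  also have "\<dots> = measure (distr (bandit_measure R \<mu>) (reward_table \<mu>) snd) (\<Union>n. D n)"
    by (intro measure_distr[symmetric]) measurable
  also have "\<dots> \<le> \<delta>"
    using D by (simp add: distr_snd_bandit_measure[OF R])
  finally show "1 - \<delta> \<le> prob (correct_event R \<mu> ?\<beta> A)"
    using prob_compl[OF F] by simp
qed

text \<open>The arms \<open>(1,1)\<close> and \<open>(2,1)\<close> share one gap, which accounts for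
  the numerator 2.\<close>

lemma complexity_eq:
  "complexity \<mu> = 8 * (2 / (\<mu> (1,1) - \<mu> (2,1))\<^sup>2 + 1 / (\<mu> (1,2) - \<mu> (2,1))\<^sup>2
      + 1 / max ((\<mu> (1,1) - \<mu> (2,1))\<^sup>2) ((\<mu> (2,2) - \<mu> (2,1))\<^sup>2))"
proof -
  have arms: "arms = {(1,1), (1,2), (2,1), (2,2)}"
    by (auto simp: arms_def)
  show ?thesis
    unfolding complexity_def arms by (simp add: gap_sq_def del: One_nat_def)
qed

theorem theorem5:
  fixes \<alpha> C :: real and R :: "'r measure" and A :: "real \<Rightarrow> 'r algorithm"
  assumes "\<alpha> > 1" and "C > 0"
    and rate_nonneg: "\<And>\<delta> t. 0 < \<delta> \<Longrightarrow> \<delta> < 1 \<Longrightarrow> 1 \<le> t \<Longrightarrow> 0 \<le> exploration_rate \<alpha> C \<delta> t"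
    and C_bound: "exp 1 * real (card arms) *
           (\<Sum>n. ln (real (Suc n)) * ln (C * real (Suc n) powr (1 + \<alpha>))
                 / real (Suc n) powr (1 + \<alpha>)) \<le> C"
    and "prob_space R"
    and "\<And>\<delta>. 0 < \<delta> \<Longrightarrow> \<delta> < 1 \<Longrightarrow> mlucb_variant (exploration_rate \<alpha> C \<delta>) R (A \<delta>)"
  shows "(\<forall>\<delta>. 0 < \<delta> \<and> \<delta> < 1 \<longrightarrow> delta_PAC R \<delta> (exploration_rate \<alpha> C \<delta>) (A \<delta>)) \<and>
         (\<forall>\<mu>. bandit_instance \<mu> \<and> \<mu> (1,1) > \<mu> (2,1) \<longrightarrow>
            Limsup (at_right 0)
              (\<lambda>\<delta>. expected_stopping_time R \<mu> (exploration_rate \<alpha> C \<delta>) (A \<delta>)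
                    / ennreal (ln (1 / \<delta>)))
            \<le> ennreal (8 * (2 / (\<mu> (1,1) - \<mu> (2,1))\<^sup>2
                           + 1 / (\<mu> (1,2) - \<mu> (2,1))\<^sup>2
                           + 1 / max ((\<mu> (1,1) - \<mu> (2,1))\<^sup>2) ((\<mu> (2,2) - \<mu> (2,1))\<^sup>2))))"
proof -
  have C: "1 \<le> C"
    by (rule rate_bound_imp_ge_1[OF \<open>C > 0\<close> rate_nonneg]) simp_all
  show ?thesis
  proof (intro conjI allI impI; elim conjE)
    fix \<delta> :: real assume "0 < \<delta>" "\<delta> < 1"
    then show "delta_PAC R \<delta> (exploration_rate \<alpha> C \<delta>) (A \<delta>)"
      by (intro delta_PAC_mlucb_variant C C_bound_imp_tail_bound[OF \<open>\<alpha> > 1\<close> C C_bound] assms)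
  next
    fix \<mu> assume "bandit_instance \<mu>" "\<mu> (2,1) < \<mu> (1,1)"
    then show "Limsup (at_right 0)
              (\<lambda>\<delta>. expected_stopping_time R \<mu> (exploration_rate \<alpha> C \<delta>) (A \<delta>)
                    / ennreal (ln (1 / \<delta>)))
            \<le> ennreal (8 * (2 / (\<mu> (1,1) - \<mu> (2,1))\<^sup>2
                           + 1 / (\<mu> (1,2) - \<mu> (2,1))\<^sup>2
                           + 1 / max ((\<mu> (1,1) - \<mu> (2,1))\<^sup>2) ((\<mu> (2,2) - \<mu> (2,1))\<^sup>2)))"
      unfolding complexity_eq[symmetric]
      by (intro Limsup_expected_stopping_time_le C assms)
  qed
qed

end
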